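(* Let $n>1$ and $m\ge 1$ be integers, let $g_1,\dots,g_m\in\mathbb{R}[\bar z,z]$ be real-valued complex polynomials on $\mathbb{C}^n$ of respective degrees $k_1,\dots,k_m$, let $K=\{z\in\mathbb{C}^n : g_i(z)\ge0,\ i=1,\dots,m\}$, let $d_K:=\max_{1\le i\le m}k_i$, and let $y\in\mathcal{H}_d$ with $d\ge d_K$. Assume that the constraints defining $K$ contain either the constraints $|z_k|^2\leqq R_k^2$, $k=1,\dots,n$, for some radii $R_k\ge0$, or the constraint $\sum_{k=1}^n|z_k|^2\leqq R^2$ for some radius $R\ge0$, where each $\leqq$ is either an equality or an inequality $\le$. Then there exists a positive $\operatorname{rank}M_{d-d_K}(y)$-atomic measure $\mu$ supported on $K$ such that $$y_{\alpha,\beta}=\int_{\mathbb{C}^n}\bar z^\alpha z^\beta\,d\mu\qquad\text{for all }|\alpha|,|\beta|\le d$$ if and only if the following three conditions hold: 1. $M_d(y)\succcurlyeq0$ and $M_{d-k_i}(g_iy)\succcurlyeq0$ for $i=1,\dots,m$; 2. $\operatorname{rank}M_d(y)=\operatorname{rank}M_{d-d_K}(y)$; 3. for all $1\le i<j\le n$, $$\begin{pmatrix} M_{d-d_K}(y) & M_{d-d_K}(\bar z_iy) & M_{d-d_K}(\bar z_jy) \\ M_{d-d_K}(z_iy) & M_{d-d_K}(|z_i|^2y) & M_{d-d_K}(\bar z_jz_iy) \\ M_{d-d_K}(z_jy) & M_{d-d_K}(\bar z_iz_jy) & M_{d-d_K}(|z_j|^2y) \end{pmatrix}\succcurlyeq0.$$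 Moreover, for each $1\le i\le m$, the measure $\mu$ has exactly $\operatorname{rank}M_d(y)-\operatorname{rank}M_{d-d_K}(g_iy)$ atoms that are zeros of $g_i$.
   Context: For $z\in\mathbb{C}^n$, $\alpha\in\mathbb{N}^n$: $z^\alpha=z_1^{\alpha_1}\cdots z_n^{\alpha_n}$, $|\alpha|=\alpha_1+\dots+\alpha_n$. $\mathbb{R}_l[\bar z,z]$ is the set of functions $\sum_{|\alpha|,|\beta|\le l}\varphi_{\alpha,\beta}\bar z^\alpha z^\beta$ ($\varphi_{\alpha,\beta}\in\mathbb{C}$) that are real-valued on $\mathbb{C}^n$; $\mathbb{R}[\bar z,z]=\bigcup_l\mathbb{R}_l[\bar z,z]$. The degree $k_i$ of $g_i$ means: $g_i\in\mathbb{R}_{k_i}[\bar z,z]$ and there exist $|\alpha|=k_i$, $|\beta|\le k_i$ with $g_{i,\alpha,\beta}\ne0$. $\mathcal{H}_d$ is the set of complex families $y=(y_{\alpha,\beta})_{|\alpha|,|\beta|\le d}$ (multi-indices in $\mathbb{N}^n$) with $\overline{y_{\alpha,\beta}}=y_{\beta,\alpha}$. For a polynomial $\varphi=\sum\varphi_{\gamma,\delta}\bar z^\gamma z^\delta$ with complex coefficients, $M_t(\varphi y)$ is the matrix indexed by multi-indices $|\alpha|,|\beta|\le t$ with entries $M_t(\varphi y)(\alpha,\beta)=\sum_{\gamma,\delta}\varphi_{\gamma,\delta}\,y_{\alpha+\gamma,\beta+\delta}$, and $M_t(y):=M_t(1\cdot y)=(y_{\alpha,\beta})_{|\alpha|,|\beta|\le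 t}$. An equality constraint is encoded as two opposite inequality constraints among the $g_i\ge0$. A positive $r$-atomic measure is a measure $\sum_{j=1}^r\lambda_j\delta_{z(j)}$ with $\lambda_j>0$ and distinct points (atoms) $z(j)$. $\succcurlyeq0$ means Hermitian positive semidefinite. *)

theory Defs
  imports "HOL-Probability.Probability" "HOL-Library.Poly_Mapping" "HOL-Library.Function_Algebras"
begin

text \<open>
  Complex n-space is \<open>complex ^ 'n\<close>, with \<open>n = CARD('n)\<close>; the order on \<open>'n\<close> plays the role of the
  order on the coordinate indices 1, ..., n.
\<close>

subsection \<open>Polynomials in the variables and their conjugates\<close>

type_synonym 'n mindex = "nat ^ 'n"

definition mdeg :: "'n::finite mindex \<Rightarrow> nat" where
  "mdeg \<alpha> = (\<Sum>i\<in>UNIV. \<alpha> $ i)"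

definition mindices :: "nat \<Rightarrow> 'n::finite mindex set" where
  "mindices t = {\<alpha>. mdeg \<alpha> \<le> t}"

definition mpow :: "complex ^ 'n \<Rightarrow> 'n::finite mindex \<Rightarrow> complex" where
  "mpow z \<alpha> = (\<Prod>i\<in>UNIV. (z $ i) ^ (\<alpha> $ i))"

definition conj_vec :: "complex ^ 'n \<Rightarrow> complex ^ 'n::finite" where
  "conj_vec z = (\<chi> i. cnj (z $ i))"

text \<open>
  The coefficient at the pair \<open>(\<alpha>, \<beta>)\<close> belongs to the monomial that has exponent \<open>\<alpha>\<close> in the conjugate
  variables and exponent \<open>\<beta>\<close> in the variables. A polynomial is determined by the function on
  complex n-space that it induces, so the coefficient families and the functions can be identified.
\<close>

type_synonym 'n cpoly = "('n mindex \<times> 'n mindex) \<Rightarrow>\<^sub>0 complex"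

abbreviation pcoeff :: "'n::finite cpoly \<Rightarrow> 'n mindex \<Rightarrow> 'n mindex \<Rightarrow> complex" where
  "pcoeff \<phi> \<alpha> \<beta> \<equiv> Poly_Mapping.lookup \<phi> (\<alpha>, \<beta>)"

definition peval :: "'n::finite cpoly \<Rightarrow> complex ^ 'n \<Rightarrow> complex" where
  "peval \<phi> z = (\<Sum>(\<alpha>, \<beta>)\<in>Poly_Mapping.keys \<phi>. pcoeff \<phi> \<alpha> \<beta> * mpow (conj_vec z) \<alpha> * mpow z \<beta>)"

definition pconst :: "complex \<Rightarrow> 'n::finite cpoly" where
  "pconst c = Poly_Mapping.single (0, 0) c"

definition pvar :: "'n::finite \<Rightarrow> 'n cpoly" where
  "pvar i = Poly_Mapping.single (0, axis i 1) 1"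

definition pcvar :: "'n::finite \<Rightarrow> 'n cpoly" where
  "pcvar i = Poly_Mapping.single (axis i 1, 0) 1"

definition real_polys :: "nat \<Rightarrow> 'n::finite cpoly set" where
  "real_polys l = {\<phi>. (\<forall>(\<alpha>, \<beta>)\<in>Poly_Mapping.keys \<phi>. mdeg \<alpha> \<le> l \<and> mdeg \<beta> \<le> l) \<and> (\<forall>z. peval \<phi> z \<in> \<real>)}"

text \<open>The zero polynomial has no degree in this sense.\<close>

definition has_degree :: "'n::finite cpoly \<Rightarrow> nat \<Rightarrow> bool" where
  "has_degree \<phi> k \<longleftrightarrow> \<phi> \<in> real_polys k \<and>
     (\<exists>\<alpha> \<beta>. mdeg \<alpha> = k \<and> mdeg \<beta> \<le> k \<and> pcoeff \<phi> \<alpha> \<beta> \<noteq> 0)"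

text \<open>The values of the \<open>g i\<close> are real in all uses, so that \<open>Re\<close> only changes the type.\<close>

definition feasible_set :: "nat \<Rightarrow> (nat \<Rightarrow> 'n::finite cpoly) \<Rightarrow> (complex ^ 'n) set" where
  "feasible_set m g = {z. \<forall>i\<in>{1..m}. 0 \<le> Re (peval (g i) z)}"

text \<open>
  The constraint \<open>p \<le> q\<close> is listed as \<open>q - p \<ge> 0\<close>, and \<open>p = q\<close> as the two opposite inequalities.
\<close>

definition contains_le :: "nat \<Rightarrow> (nat \<Rightarrow> 'n::finite cpoly) \<Rightarrow> 'n cpoly \<Rightarrow> 'n cpoly \<Rightarrow> bool" where
  "contains_le m g p q \<longleftrightarrow> (\<exists>i\<in>{1..m}. g i = q - p)"

definition contains_eq :: "nat \<Rightarrow> (nat \<Rightarrow> 'n::finite cpoly) \<Rightarrow> 'n cpoly \<Rightarrow> 'n cpoly \<Rightarrow> bool" where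
  "contains_eq m g p q \<longleftrightarrow> contains_le m g p q \<and> contains_le m g q p"

definition contains_le_or_eq :: "nat \<Rightarrow> (nat \<Rightarrow> 'n::finite cpoly) \<Rightarrow> 'n cpoly \<Rightarrow> 'n cpoly \<Rightarrow> bool" where
  "contains_le_or_eq m g p q \<longleftrightarrow> contains_le m g p q \<or> contains_eq m g p q"

subsection \<open>Matrices indexed by a finite set\<close>

text \<open>
  A complex matrix with rows and columns indexed by a finite set \<open>A\<close> is a function of two
  arguments of which only the values on \<open>A \<times> A\<close> matter.
\<close>

definition psd_mat :: "'a set \<Rightarrow> ('a \<Rightarrow> 'a \<Rightarrow> complex) \<Rightarrow> bool" where
  "psd_mat A M \<longleftrightarrow> (\<forall>a\<in>A. \<forall>b\<in>A. M b a = cnj (M a b)) \<and>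
     (\<forall>v. 0 \<le> Re (\<Sum>a\<in>A. \<Sum>b\<in>A. cnj (v a) * M a b * v b))"

interpretation cfun: vector_space "\<lambda>(c::complex) (v::'a \<Rightarrow> complex) a. c * v a"
  by unfold_locales (auto simp: fun_eq_iff algebra_simps)

text \<open>The rank is the dimension of the column space; columns are extended by zero outside \<open>A\<close>.\<close>

definition rank_mat :: "'a set \<Rightarrow> ('a \<Rightarrow> 'a \<Rightarrow> complex) \<Rightarrow> nat" where
  "rank_mat A M = cfun.dim ((\<lambda>b a. if a \<in> A then M a b else 0) ` A)"

definition block_mat :: "('a \<Rightarrow> 'a \<Rightarrow> complex) list list \<Rightarrow> nat \<times> 'a \<Rightarrow> nat \<times> 'a \<Rightarrow> complex" where
  "block_mat Ms = (\<lambda>(p, a) (q, b). (Ms ! p ! q) a b)"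

subsection \<open>Truncated moment families\<close>

text \<open>
  A family indexed by the multi-indices of degree at most \<open>d\<close> is given by a total function whose
  values at other indices are arbitrary; they are not used.
\<close>

definition hermitian_family :: "nat \<Rightarrow> ('n::finite mindex \<Rightarrow> 'n mindex \<Rightarrow> complex) \<Rightarrow> bool" where
  "hermitian_family d y \<longleftrightarrow> (\<forall>\<alpha>\<in>mindices d. \<forall>\<beta>\<in>mindices d. cnj (y \<alpha> \<beta>) = y \<beta> \<alpha>)"

text \<open>
  The entries of the localizing matrix for \<open>\<phi>\<close>; the truncation order \<open>t\<close> enters through the index set
  \<open>mindices t\<close>. The moment matrix is the case \<open>\<phi> = 1\<close>.
\<close>

definition loc_mat :: "'n::finite cpoly \<Rightarrow> ('n mindex \<Rightarrow> 'n mindex \<Rightarrow> complex)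
    \<Rightarrow> 'n mindex \<Rightarrow> 'n mindex \<Rightarrow> complex" where
  "loc_mat \<phi> y \<alpha> \<beta> = (\<Sum>(\<gamma>, \<delta>)\<in>Poly_Mapping.keys \<phi>. pcoeff \<phi> \<gamma> \<delta> * y (\<alpha> + \<gamma>) (\<beta> + \<delta>))"

subsection \<open>Atomic measures\<close>

definition atomic_measure :: "nat \<Rightarrow> (complex ^ 'n::finite) measure \<Rightarrow> bool" where
  "atomic_measure r \<mu> \<longleftrightarrow> sets \<mu> = sets borel \<and>
     (\<exists>Z w. finite Z \<and> card Z = r \<and> (\<forall>z\<in>Z. 0 < (w z :: real)) \<and>
        (\<forall>B\<in>sets borel. emeasure \<mu> B = (\<Sum>z\<in>Z. ennreal (w z) * emeasure (return borel z) B)))"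

definition atoms :: "(complex ^ 'n::finite) measure \<Rightarrow> (complex ^ 'n) set" where
  "atoms \<mu> = {z. 0 < emeasure \<mu> {z}}"

definition atomic_representing_measure :: "nat \<Rightarrow> (complex ^ 'n) set \<Rightarrow> nat
    \<Rightarrow> ('n::finite mindex \<Rightarrow> 'n mindex \<Rightarrow> complex) \<Rightarrow> (complex ^ 'n) measure \<Rightarrow> bool" where
  "atomic_representing_measure r K d y \<mu> \<longleftrightarrow> atomic_measure r \<mu> \<and> (AE z in \<mu>. z \<in> K) \<and>
     (\<forall>\<alpha>\<in>mindices d. \<forall>\<beta>\<in>mindices d. y \<alpha> \<beta> = (LINT z|\<mu>. mpow (conj_vec z) \<alpha> * mpow z \<beta>))"

end

theory Submission
  imports Defs "HOL-Computational_Algebra.Fundamental_Theorem_Algebra"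
begin

text \<open>
  Write \<open>M_d(y)\<close> as the Gram matrix of vectors \<open>x \<alpha>\<close>. By flatness the \<open>x \<alpha>\<close> with
  \<open>|\<alpha>| \<le> d - d_K\<close> already span, and the localizing matrix of the ball constraint makes the shifts
  \<open>T k : x \<alpha> \<mapsto> x (\<alpha> + e k)\<close> well defined. Condition 3 says that any two shifts are jointly
  hyponormal; in finite dimension the commutators with adjoints then have trace zero and are
  positive, so that every \<open>T k\<close> commutes with every adjoint. Hence the shifts are commuting normal
  operators, and the components of \<open>x 0\<close> in their joint eigenspaces give the atoms (the
  joint eigenvalues) and the weights (the squared norms). Since the \<open>x \<alpha>\<close> span, the monomials of
  degree at most \<open>d - d_K\<close> separate the atoms. This yields the number of atoms, the constraints
  \<open>g i \<ge> 0\<close> at each atom, and the rank of each localizing matrix.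
\<close>

subsection \<open>Gram matrices and rank\<close>

text \<open>The moment matrix has no Hankel structure: raising the first index of \<open>y\<close>
  and raising the second are different operations, exchanged only by conjugation. A linear relation
  among the \<open>x \<alpha>\<close> is therefore not automatically inherited by the shifted
  vectors. The radius bounds repair this: for every combination of vectors of degree at most
  \<open>d - 1\<close>, the squared norm of the shifted combination is at most a constant times the
  original one, so null combinations stay null. Nor do the shifts visibly commute: if
  \<open>d_K = 1\<close>, then \<open>T k (x \<alpha>) = x (\<alpha> + e k)\<close> may already have
  degree \<open>d\<close>, and a second shift cannot be read off from the data. Commutation is
  recovered from the relations with the adjoints, by a finite-dimensional Fuglede argument on
  eigenspaces. Each of these relations involves at most two indices, so a condition on pairs
  suffices; \<open>n > 1\<close> gives every index a partner, from which its normality is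
  obtained.\<close>

definition cinner :: "'p set \<Rightarrow> ('p \<Rightarrow> complex) \<Rightarrow> ('p \<Rightarrow> complex) \<Rightarrow> complex" where
  "cinner P u v = (\<Sum>p\<in>P. cnj (u p) * v p)"

text \<open>The vectors \<open>x a\<close> span all of complex \<open>P\<close>-space, phrased
  through the unit vectors. The coefficients are kept explicit because the same predicate is used
  with \<open>P\<close> a set of points and \<open>x a z = mpow z a\<close>; they are then the
  coefficients of Lagrange interpolation polynomials.\<close>

definition spanning :: "'a set \<Rightarrow> 'p set \<Rightarrow> ('a \<Rightarrow> 'p \<Rightarrow> complex) \<Rightarrow> bool" where
  "spanning A P x \<longleftrightarrow>
     (\<forall>p\<in>P. \<exists>c. \<forall>q\<in>P. (\<Sum>a\<in>A. c a * x a q) = (if q = p then 1 else 0))"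

lemma cinner_combination:
  "cinner P (\<lambda>p. \<Sum>a\<in>A. u a * x a p) (\<lambda>p. \<Sum>b\<in>B. v b * y b p) =
     (\<Sum>a\<in>A. \<Sum>b\<in>B. cnj (u a) * cinner P (x a) (y b) * v b)"
proof -
  have "cinner P (\<lambda>p. \<Sum>a\<in>A. u a * x a p) (\<lambda>p. \<Sum>b\<in>B. v b * y b p) =
      (\<Sum>p\<in>P. \<Sum>a\<in>A. \<Sum>b\<in>B. cnj (u a) * (cnj (x a p) * y b p) * v b)"
    unfolding cinner_def cnj_sum sum_product by (intro sum.cong refl) (simp add: algebra_simps)
  also have "\<dots> = (\<Sum>a\<in>A. \<Sum>p\<in>P. \<Sum>b\<in>B. cnj (u a) * (cnj (x a p) * y b p) * v b)"
    by (rule sum.swap)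
  also have "\<dots> = (\<Sum>a\<in>A. \<Sum>b\<in>B. \<Sum>p\<in>P. cnj (u a) * (cnj (x a p) * y b p) * v b)"
    by (intro sum.cong refl sum.swap)
  finally show ?thesis
    unfolding cinner_def by (simp add: sum_distrib_left sum_distrib_right)
qed

lemma cinner_cong:
  "(\<And>p. p \<in> P \<Longrightarrow> u p = u' p) \<Longrightarrow> (\<And>p. p \<in> P \<Longrightarrow> v p = v' p) \<Longrightarrow> cinner P u v = cinner P u' v'"
  unfolding cinner_def by (intro sum.cong) auto

lemma cinner_commute: "cinner P v u = cnj (cinner P u v)"
  unfolding cinner_def by (simp add: mult.commute)

lemma cinner_self: "cinner P u u = of_real (\<Sum>p\<in>P. (cmod (u p))\<^sup>2)"
  unfolding cinner_def of_real_sum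
  by (intro sum.cong refl) (metis complex_norm_square mult.commute)

lemma cinner_self_nonneg: "0 \<le> Re (cinner P u u)"
  unfolding cinner_self by (simp add: sum_nonneg)

lemma cinner_self_eq_0:
  assumes "finite P"
  shows "cinner P u u = 0 \<longleftrightarrow> (\<forall>p\<in>P. u p = 0)"
proof -
  have "cinner P u u = 0 \<longleftrightarrow> (\<Sum>p\<in>P. (cmod (u p))\<^sup>2) = 0"
    unfolding cinner_self of_real_eq_0_iff ..
  then show ?thesis
    using assms by (simp add: sum_nonneg_eq_0_iff)
qed

lemma cinner_scale_left: "cinner P (\<lambda>p. c * u p) w = cnj c * cinner P u w"
  and cinner_scale_right: "cinner P w (\<lambda>p. c * u p) = c * cinner P w u"
  and cinner_diff_left: "cinner P (\<lambda>p. u p - v p) w = cinner P u w - cinner P v w"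
  and cinner_diff_right: "cinner P w (\<lambda>p. u p - v p) = cinner P w u - cinner P w v"
  unfolding cinner_def
  by (simp_all add: algebra_simps sum_distrib_left sum_subtractf)

lemma psd_gram:
  fixes A :: "'a set"
  assumes "\<And>a b. a \<in> A \<Longrightarrow> b \<in> A \<Longrightarrow> M a b = cinner P (x a) (x b)"
  shows "psd_mat A M"
  unfolding psd_mat_def
proof (intro conjI ballI allI)
  fix a b assume "a \<in> A" "b \<in> A"
  then show "M b a = cnj (M a b)"
    using assms by (metis cinner_commute)
next
  fix v :: "'a \<Rightarrow> complex"
  have "(\<Sum>a\<in>A. \<Sum>b\<in>A. cnj (v a) * M a b * v b) =
      cinner P (\<lambda>p. \<Sum>a\<in>A. v a * x a p) (\<lambda>p. \<Sum>b\<in>A. v b * x b p)"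
    unfolding cinner_combination by (intro sum.cong refl) (simp add: assms)
  then show "0 \<le> Re (\<Sum>a\<in>A. \<Sum>b\<in>A. cnj (v a) * M a b * v b)"
    by (simp add: cinner_self_nonneg)
qed

lemma psd_mat_form_nonneg:
  "psd_mat A M \<Longrightarrow> 0 \<le> Re (\<Sum>a\<in>A. \<Sum>b\<in>A. cnj (v a) * M a b * v b)"
  unfolding psd_mat_def by blast

lemma psd_mat_hermitian: "psd_mat A M \<Longrightarrow> a \<in> A \<Longrightarrow> b \<in> A \<Longrightarrow> M b a = cnj (M a b)"
  unfolding psd_mat_def by blast

lemma psd_mat_subset:
  fixes A :: "'a set"
  assumes "psd_mat A M" "B \<subseteq> A" "finite A"
  shows "psd_mat B M"
  unfolding psd_mat_def
proof (intro conjI ballI allI)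
  fix a b assume "a \<in> B" "b \<in> B"
  then show "M b a = cnj (M a b)"
    using assms psd_mat_hermitian by (metis subsetD)
next
  fix v :: "'a \<Rightarrow> complex"
  let ?v = "\<lambda>a. if a \<in> B then v a else 0"
  have "(\<Sum>a\<in>A. \<Sum>b\<in>A. cnj (?v a) * M a b * ?v b) = (\<Sum>a\<in>B. \<Sum>b\<in>A. cnj (?v a) * M a b * ?v b)"
    using assms by (intro sum.mono_neutral_right) auto
  also have "\<dots> = (\<Sum>a\<in>B. \<Sum>b\<in>B. cnj (?v a) * M a b * ?v b)"
    using assms by (intro sum.cong refl sum.mono_neutral_right) auto
  also have "\<dots> = (\<Sum>a\<in>B. \<Sum>b\<in>B. cnj (v a) * M a b * v b)"
    by (intro sum.cong refl) auto
  finally show "0 \<le> Re (\<Sum>a\<in>B. \<Sum>b\<in>B. cnj (v a) * M a b * v b)"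
    using psd_mat_form_nonneg[OF assms(1), of ?v] by simp
qed

lemma psd_mat_diag:
  assumes "psd_mat A M" "a \<in> A" "finite A"
  shows "M a a = of_real (Re (M a a))" "0 \<le> Re (M a a)"
proof -
  have "M a a = cnj (M a a)"
    by (rule psd_mat_hermitian[OF assms(1,2,2)])
  then show "M a a = of_real (Re (M a a))"
    by (simp add: complex_eq_iff)
  have "psd_mat {a} M"
    by (rule psd_mat_subset[OF assms(1) _ assms(3)]) (use assms(2) in simp)
  from psd_mat_form_nonneg[OF this, of "\<lambda>_. 1"] show "0 \<le> Re (M a a)"
    by simp
qed

text \<open>At the vector with entry 1 at \<open>a\<close> and \<open>- n * cnj (M a b)\<close> at
  \<open>b\<close>, the form equals \<open>M a a\<close> minus \<open>2 n\<close> times the squared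
  modulus of \<open>M a b\<close>. It cannot stay nonnegative for all \<open>n\<close> unless
  \<open>M a b = 0\<close>.\<close>

lemma psd_mat_zero_diag:
  assumes "psd_mat A M" "finite A" "a \<in> A" "b \<in> A" "M b b = 0"
  shows "M a b = 0"
proof (cases "a = b")
  case False
  have psd: "psd_mat {a, b} M"
    using psd_mat_subset assms by (metis empty_subsetI insert_subset)
  have ba: "M b a = cnj (M a b)"
    using psd_mat_hermitian assms by metis
  have bound: "2 * (real n * (cmod (M a b))\<^sup>2) \<le> Re (M a a)" for n :: nat
  proof -
    let ?v = "\<lambda>c. if c = a then 1 else - of_nat n * cnj (M a b)"
    have "0 \<le> Re (M a a - of_nat n * (M a b * cnj (M a b)) - of_nat n * (M a b * cnj (M a b)))"
      using psd_mat_form_nonneg[OF psd, of ?v] False assms(5) ba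
      by (simp add: algebra_simps)
    then show ?thesis
      by (simp flip: complex_norm_square)
  qed
  show ?thesis
  proof (rule ccontr)
    assume "M a b \<noteq> 0"
    then obtain n where "Re (M a a) < real n * (cmod (M a b))\<^sup>2"
      using ex_less_of_nat_mult[of "(cmod (M a b))\<^sup>2" "Re (M a a)"] by auto
    moreover have "0 \<le> real n * (cmod (M a b))\<^sup>2"
      by simp
    ultimately show False
      using bound[of n] by linarith
  qed
qed (use assms in simp)

text \<open>The diagonal entries are nonnegative, so a zero trace makes each of them zero, and a
  zero diagonal entry clears its column.\<close>

lemma psd_mat_trace_0:
  assumes "psd_mat A M" "finite A" "(\<Sum>a\<in>A. M a a) = 0" "a \<in> A" "b \<in> A"
  shows "M a b = 0"
proof -
  have "(\<Sum>a\<in>A. Re (M a a)) = 0"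
    using assms(3) by (metis Re_sum zero_complex.simps(1))
  then have "Re (M b b) = 0"
    using assms psd_mat_diag(2)[OF assms(1) _ assms(2)] by (simp add: sum_nonneg_eq_0_iff)
  then have "M b b = 0"
    using psd_mat_diag(1)[OF assms(1) assms(5) assms(2)] by simp
  then show ?thesis
    using psd_mat_zero_diag assms by metis
qed

lemma spanning_coordinates:
  assumes "spanning A P x" "finite P"
  shows "\<exists>c. \<forall>q\<in>P. (\<Sum>a\<in>A. c a * x a q) = u q"
proof -
  obtain C where C: "\<And>p q. p \<in> P \<Longrightarrow> q \<in> P \<Longrightarrow> (\<Sum>a\<in>A. C p a * x a q) = (if q = p then 1 else 0)"
    using assms(1) unfolding spanning_def by metis
  have "(\<Sum>a\<in>A. (\<Sum>p\<in>P. u p * C p a) * x a q) = u q" if "q \<in> P" for q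
  proof -
    have "(\<Sum>a\<in>A. (\<Sum>p\<in>P. u p * C p a) * x a q) = (\<Sum>p\<in>P. \<Sum>a\<in>A. u p * C p a * x a q)"
      by (subst sum.swap) (simp add: sum_distrib_right)
    also have "\<dots> = (\<Sum>p\<in>P. u p * (if q = p then 1 else 0))"
      using C that by (intro sum.cong refl) (simp add: sum_distrib_left mult.assoc flip: C)
    also have "\<dots> = u q"
      using that assms(2) by (simp add: if_distrib sum.delta cong: if_cong)
    finally show ?thesis .
  qed
  then show ?thesis
    by (intro exI[of _ "\<lambda>a. \<Sum>p\<in>P. u p * C p a"]) auto
qed

lemma spanning_mono:
  assumes "spanning A P x" "A \<subseteq> B" "finite B"
  shows "spanning B P x"
  unfolding spanning_def
proof
  fix p assume "p \<in> P"
  then obtain c where c: "\<forall>q\<in>P. (\<Sum>a\<in>A. c a * x a q) = (if q = p then 1 else 0)"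
    using assms(1) unfolding spanning_def by blast
  have "(\<Sum>a\<in>B. (if a \<in> A then c a else 0) * x a q) = (\<Sum>a\<in>A. c a * x a q)" for q
    using assms by (intro sum.mono_neutral_cong_right) auto
  then show "\<exists>c. \<forall>q\<in>P. (\<Sum>a\<in>B. c a * x a q) = (if q = p then 1 else 0)"
    using c by (intro exI[of _ "\<lambda>a. if a \<in> A then c a else 0"]) simp
qed

text \<open>Cholesky: subtracting \<open>M a a0 * M a0 b / M a0 a0\<close> clears the row and the column of \<open>a0\<close>.\<close>

lemma psd_gram_factorization:
  assumes "finite A" "psd_mat A M"
  shows "\<exists>(r::nat) x. (\<forall>a\<in>A. \<forall>b\<in>A. M a b = cinner {..<r} (x a) (x b)) \<and> spanning A {..<r} x"
  using assms(2)
proof (induction "card {a \<in> A. M a a \<noteq> 0}" arbitrary: M rule: less_induct)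
  case less
  show ?case
  proof (cases "\<forall>a\<in>A. M a a = 0")
    case True
    then have "\<forall>a\<in>A. \<forall>b\<in>A. M a b = 0"
      using psd_mat_zero_diag[OF less.prems assms(1)] by blast
    then show ?thesis
      by (intro exI[of _ 0]) (simp add: cinner_def spanning_def)
  next
    case False
    then obtain a0 where a0: "a0 \<in> A" "M a0 a0 \<noteq> 0"
      by blast
    define s where "s = Re (M a0 a0)"
    have s: "M a0 a0 = of_real s" "s > 0"
      using psd_mat_diag[OF less.prems a0(1) assms(1)] a0(2) unfolding s_def
      by (auto simp: less_le)
    have herm: "cnj (M a b) = M b a" if "a \<in> A" "b \<in> A" for a b
      using psd_mat_hermitian[OF less.prems that] by simp
    define M' where "M' = (\<lambda>a b. M a b - M a a0 * M a0 b / of_real s)"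
    have "psd_mat A M'"
      unfolding psd_mat_def
    proof (intro conjI ballI allI)
      fix a b assume "a \<in> A" "b \<in> A"
      then show "M' b a = cnj (M' a b)"
        unfolding M'_def using a0(1) by (simp add: herm)
    next
      fix v
      \<comment> \<open>Completing the square: \<open>t\<close> is the coefficient of the projection
        of \<open>v\<close> onto \<open>a0\<close> with respect to the form of \<open>M\<close>. At
        \<open>v - e\<close>, the part orthogonal to \<open>a0\<close>, the form of \<open>M\<close>
        has the value of the form of \<open>M'\<close> at \<open>v\<close>.\<close>
      define t where "t = (\<Sum>b\<in>A. M a0 b * v b) / of_real s"
      define e where "e = (\<lambda>a. if a = a0 then t else 0)"
      have st: "(\<Sum>b\<in>A. M a0 b * v b) = of_real s * t"
        using s unfolding t_def by simp
      have st': "(\<Sum>a\<in>A. cnj (v a) * M a a0) = of_real s * cnj t"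
        using arg_cong[OF st, of cnj] a0(1) by (simp add: herm mult.commute)
      have e_left: "(\<Sum>a\<in>A. cnj (e a) * f a) = cnj t * f a0" for f
        using a0(1) assms(1) unfolding e_def by (simp add: if_distrib if_distribR sum.delta cong: if_cong)
      have e_right: "(\<Sum>a\<in>A. f a * e a) = f a0 * t" for f
        using a0(1) assms(1) unfolding e_def by (simp add: if_distrib if_distribR sum.delta cong: if_cong)
      have "(\<Sum>a\<in>A. \<Sum>b\<in>A. cnj (v a - e a) * M a b * (v b - e b)) =
          (\<Sum>a\<in>A. \<Sum>b\<in>A. cnj (v a) * M a b * v b) - (\<Sum>a\<in>A. cnj (e a) * (\<Sum>b\<in>A. M a b * v b))
          - (\<Sum>a\<in>A. cnj (v a) * (\<Sum>b\<in>A. M a b * e b)) + (\<Sum>a\<in>A. cnj (e a) * (\<Sum>b\<in>A. M a b * e b))"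
        unfolding sum_distrib_left sum_subtractf[symmetric] sum.distrib[symmetric]
        by (intro sum.cong refl) (simp add: algebra_simps)
      also have "\<dots> = (\<Sum>a\<in>A. \<Sum>b\<in>A. cnj (v a) * M a b * v b) - cnj t * (of_real s * t)"
      proof -
        have "(\<Sum>a\<in>A. cnj (v a) * (M a a0 * t)) = of_real s * cnj t * t"
          unfolding st'[symmetric] sum_distrib_right by (simp add: mult.assoc)
        then show ?thesis
          unfolding e_left e_right st s(1) by simp
      qed
      also have "\<dots> = (\<Sum>a\<in>A. \<Sum>b\<in>A. cnj (v a) * M' a b * v b)"
      proof -
        have "(\<Sum>a\<in>A. \<Sum>b\<in>A. cnj (v a) * M' a b * v b) =
            (\<Sum>a\<in>A. \<Sum>b\<in>A. cnj (v a) * M a b * v b) -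
            (\<Sum>a\<in>A. cnj (v a) * M a a0) * (\<Sum>b\<in>A. M a0 b * v b) / of_real s"
          unfolding M'_def sum_product sum_divide_distrib sum_subtractf[symmetric]
          by (intro sum.cong refl) (simp add: algebra_simps)
        then show ?thesis
          unfolding st st' using s(2) by simp
      qed
      finally show "0 \<le> Re (\<Sum>a\<in>A. \<Sum>b\<in>A. cnj (v a) * M' a b * v b)"
        using psd_mat_form_nonneg[OF less.prems, of "\<lambda>a. v a - e a"] by simp
    qed
    \<comment> \<open>Where the diagonal of \<open>M\<close> is zero, the entry
      \<open>M a0 a\<close> is zero as well, so elimination creates no new nonzero diagonal entry;
      it removes the one at \<open>a0\<close>.\<close>
    moreover have "card {a \<in> A. M' a a \<noteq> 0} < card {a \<in> A. M a a \<noteq> 0}"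
    proof (rule psubset_card_mono)
      have "M' a a = 0" if "a \<in> A" "M a a = 0" for a
        using psd_mat_zero_diag[OF less.prems assms(1) a0(1) that] that unfolding M'_def by simp
      moreover have "M' a0 a0 = 0"
        unfolding M'_def using s by simp
      ultimately show "{a \<in> A. M' a a \<noteq> 0} \<subset> {a \<in> A. M a a \<noteq> 0}"
        using a0 by blast
    qed (use assms(1) in simp)
    ultimately obtain r :: nat and x where
        x: "\<And>a b. a \<in> A \<Longrightarrow> b \<in> A \<Longrightarrow> M' a b = cinner {..<r} (x a) (x b)"
      and sp: "spanning A {..<r} x"
      using less.hyps[of M'] by blast
    have "cinner {..<r} (x a0) (x a0) = 0"
      using x[OF a0(1) a0(1)] s unfolding M'_def by simp
    then have x0: "x a0 p = 0" if "p < r" for p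
      using that by (simp add: cinner_self_eq_0)
    \<comment> \<open>Coordinate \<open>r\<close> restores the rank-one term removed by elimination.
      Since \<open>x a0\<close> vanishes below \<open>r\<close>, the vector \<open>X a0\<close> is
      \<open>sqrt s\<close> times the unit vector at \<open>r\<close>.\<close>
    define X where "X = (\<lambda>a p. if p < r then x a p else M a0 a / of_real (sqrt s))"
    have ss: "complex_of_real (sqrt s) * complex_of_real (sqrt s) = of_real s"
      using s(2) by (simp flip: of_real_mult)
    have "M a b = cinner {..<Suc r} (X a) (X b)" if "a \<in> A" "b \<in> A" for a b
    proof -
      have "cinner {..<Suc r} (X a) (X b) =
          cinner {..<r} (x a) (x b) + cnj (M a0 a) * M a0 b / of_real s"
        unfolding cinner_def X_def using ss by simp
      then show ?thesis
        using x[OF that] that a0(1) unfolding M'_def by (simp add: herm diff_eq_eq)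
    qed
    moreover have "spanning A {..<Suc r} X"
      unfolding spanning_def
    proof
      fix p assume p: "p \<in> {..<Suc r}"
      have "\<exists>c. \<forall>q<r. (\<Sum>a\<in>A. c a * x a q) = (if q = p then 1 else 0)"
      proof (cases "p < r")
        case True
        then show ?thesis
          using sp[unfolded spanning_def, THEN bspec, of p] unfolding Ball_def lessThan_iff by blast
      qed (intro exI[of _ "\<lambda>_. 0"], auto)
      then obtain c where c: "\<And>q. q < r \<Longrightarrow> (\<Sum>a\<in>A. c a * x a q) = (if q = p then 1 else 0)"
        by blast
      \<comment> \<open>The error of the old combination in coordinate \<open>r\<close>. A multiple
        of \<open>X a0\<close> corrects it without touching the other coordinates.\<close>
      define h where "h = (\<Sum>a\<in>A. c a * X a r) - (if p = r then 1 else 0)"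
      define c' where "c' = (\<lambda>a. c a - (if a = a0 then h / of_real (sqrt s) else 0))"
      have c': "(\<Sum>a\<in>A. c' a * X a q) = (\<Sum>a\<in>A. c a * X a q) - h / of_real (sqrt s) * X a0 q" for q
      proof -
        have "(\<Sum>a\<in>A. c' a * X a q) =
            (\<Sum>a\<in>A. c a * X a q) - (\<Sum>a\<in>A. if a = a0 then h / of_real (sqrt s) * X a q else 0)"
          unfolding c'_def sum_subtractf[symmetric]
          by (intro sum.cong refl) (simp add: algebra_simps)
        then show ?thesis
          using a0(1) assms(1) by (simp add: sum.delta)
      qed
      have "(\<Sum>a\<in>A. c' a * X a q) = (if q = p then 1 else 0)" if "q < Suc r" for q
      proof (cases "q = r")
        case True
        then show ?thesis
          unfolding c' h_def using s by (simp add: X_def flip: ss)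
      next
        case False
        then have "q < r"
          using that by simp
        then show ?thesis
          unfolding c' using c x0 by (simp add: X_def)
      qed
      then show "\<exists>c. \<forall>q\<in>{..<Suc r}. (\<Sum>a\<in>A. c a * X a q) = (if q = p then 1 else 0)"
        by blast
    qed
    ultimately show ?thesis
      by blast
  qed
qed

section \<open>Column rank of a Gram matrix\<close>

lemma sum_fun_apply: "(\<Sum>i\<in>I. f i) a = (\<Sum>i\<in>I. f i a)"
  by (induction I rule: infinite_finite_induct) (auto simp: plus_fun_def zero_fun_def)

lemma cfun_span_image:
  fixes f :: "'b \<Rightarrow> 'a \<Rightarrow> complex"
  assumes "finite A" "v \<in> cfun.span (f ` A)"
  shows "\<exists>c. v = (\<lambda>a. \<Sum>b\<in>A. c b * f b a)"
proof -
  let ?S = "range (\<lambda>c a. \<Sum>b\<in>A. c b * f b a)"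
  have "cfun.subspace ?S"
  proof (rule cfun.subspaceI)
    show "0 \<in> ?S"
      by (rule range_eqI[of _ _ "\<lambda>_. 0"]) (simp add: zero_fun_def)
  next
    fix u w assume "u \<in> ?S" "w \<in> ?S"
    then obtain c c' where "u = (\<lambda>a. \<Sum>b\<in>A. c b * f b a)" "w = (\<lambda>a. \<Sum>b\<in>A. c' b * f b a)"
      by blast
    then show "u + w \<in> ?S"
      by (intro range_eqI[of _ _ "\<lambda>b. c b + c' b"])
         (simp add: plus_fun_def sum.distrib distrib_right)
  next
    fix s u assume "u \<in> ?S"
    then obtain c where "u = (\<lambda>a. \<Sum>b\<in>A. c b * f b a)"
      by blast
    then show "(\<lambda>a. s * u a) \<in> ?S"
      by (intro range_eqI[of _ _ "\<lambda>b. s * c b"]) (simp add: sum_distrib_left mult.assoc)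
  qed
  moreover have "f ` A \<subseteq> ?S"
  proof
    fix w assume "w \<in> f ` A"
    then obtain b where b: "b \<in> A" "w = f b"
      by blast
    have "(\<Sum>b'\<in>A. (if b' = b then 1 else 0) * f b' a) = w a" for a
      using b assms(1) by (simp add: if_distrib if_distribR sum.delta cong: if_cong)
    then show "w \<in> ?S"
      by (intro range_eqI[of _ _ "\<lambda>b'. if b' = b then 1 else 0"]) (simp add: fun_eq_iff)
  qed
  ultimately have "cfun.span (f ` A) \<subseteq> ?S"
    by (intro cfun.span_minimal)
  then show ?thesis
    using assms(2) by blast
qed

lemma cfun_combination_in_span:
  fixes f :: "'b \<Rightarrow> 'a \<Rightarrow> complex"
  assumes "\<And>b. b \<in> A \<Longrightarrow> f b \<in> cfun.span S"
  shows "(\<lambda>a. \<Sum>b\<in>A. c b * f b a) \<in> cfun.span S"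
proof -
  have "(\<Sum>b\<in>A. (\<lambda>a. c b * f b a)) \<in> cfun.span S"
    by (intro cfun.span_sum cfun.span_scale assms)
  moreover have "(\<Sum>b\<in>A. (\<lambda>a. c b * f b a)) = (\<lambda>a. \<Sum>b\<in>A. c b * f b a)"
    by (simp add: fun_eq_iff sum_fun_apply)
  ultimately show ?thesis
    by simp
qed

text \<open>Every column of \<open>M\<close> is a combination of the conjugated coordinate functions
  \<open>\<phi> q\<close> of the Gram vectors. If the vectors span, the \<open>\<phi> q\<close> are
  independent and are in turn combinations of columns, so they form a basis of the column
  space.\<close>

lemma rank_gram_spanning:
  fixes M :: "'a \<Rightarrow> 'a \<Rightarrow> complex"
  assumes fin: "finite A" "finite P"
    and gram: "\<And>a b. a \<in> A \<Longrightarrow> b \<in> A \<Longrightarrow> M a b = cinner P (x a) (x b)"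
    and sp: "spanning A P x"
  shows "rank_mat A M = card P"
proof -
  define \<phi> where "\<phi> = (\<lambda>q a. if a \<in> A then cnj (x a q) else 0)"
  define col where "col = (\<lambda>b a. if a \<in> A then M a b else 0)"
  have col: "col b = (\<lambda>a. \<Sum>q\<in>P. x b q * \<phi> q a)" if "b \<in> A" for b
    using that gram unfolding col_def \<phi>_def cinner_def by (auto simp: fun_eq_iff mult.commute)
  \<comment> \<open>Summing the relation against the conjugated coefficients that produce the unit
    vector at \<open>p\<close> isolates \<open>u p\<close>.\<close>
  have indep: "u p = 0" if u: "\<And>a. a \<in> A \<Longrightarrow> (\<Sum>q\<in>P. u q * \<phi> q a) = 0" and p: "p \<in> P" for u p
  proof -
    obtain c where c: "\<And>q. q \<in> P \<Longrightarrow> (\<Sum>a\<in>A. c a * x a q) = (if q = p then 1 else 0)"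
      using sp p unfolding spanning_def by blast
    have "0 = (\<Sum>a\<in>A. cnj (c a) * (\<Sum>q\<in>P. u q * \<phi> q a))"
      by (simp add: u)
    also have "\<dots> = (\<Sum>q\<in>P. u q * cnj (\<Sum>a\<in>A. c a * x a q))"
      unfolding sum_distrib_left cnj_sum
      by (subst sum.swap) (intro sum.cong refl, simp add: \<phi>_def mult_ac)
    also have "\<dots> = (\<Sum>q\<in>P. if q = p then u q else 0)"
      by (intro sum.cong refl) (simp add: c)
    finally show ?thesis
      using p fin(2) by (simp add: sum.delta)
  qed
  \<comment> \<open>Independence concerns the image set, which does not see repetitions; injectivity
    gives it cardinality \<open>card P\<close>.\<close>
  have inj: "inj_on \<phi> P"
  proof (rule inj_onI)
    fix p q assume pq: "p \<in> P" "q \<in> P" "\<phi> p = \<phi> q"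
    show "p = q"
    proof (rule ccontr)
      assume ne: "p \<noteq> q"
      let ?u = "\<lambda>s. (if s = p then 1 else 0) - (if s = q then 1 else 0) :: complex"
      have "(\<Sum>s\<in>P. ?u s * \<phi> s a) = \<phi> p a - \<phi> q a" for a
      proof -
        have "(\<Sum>s\<in>P. ?u s * \<phi> s a) =
            (\<Sum>s\<in>P. if s = p then \<phi> s a else 0) - (\<Sum>s\<in>P. if s = q then \<phi> s a else 0)"
          unfolding sum_subtractf[symmetric] by (intro sum.cong refl) auto
        then show ?thesis
          using pq(1,2) fin(2) by (simp add: sum.delta)
      qed
      from indep[of ?u p, OF _ pq(1)] this show False
        using ne pq(3) by simp
    qed
  qed
  have "cfun.independent (\<phi> ` P)"
    unfolding cfun.dependent_finite[OF finite_imageI[OF fin(2)]]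
  proof (clarsimp)
    fix u p assume sum0: "(\<Sum>v\<in>\<phi> ` P. (\<lambda>a. u v * v a)) = 0" and p: "p \<in> P" "u (\<phi> p) \<noteq> 0"
    have "(\<Sum>q\<in>P. u (\<phi> q) * \<phi> q a) = 0" for a
      using fun_cong[OF sum0, of a] unfolding sum_fun_apply by (simp add: sum.reindex[OF inj])
    then show False
      using indep[of "\<lambda>q. u (\<phi> q)" p] p by simp
  qed
  moreover have "cfun.span (\<phi> ` P) = cfun.span (col ` A)"
  proof (rule antisym[rotated])
    show "cfun.span (col ` A) \<subseteq> cfun.span (\<phi> ` P)"
    proof (rule cfun.span_minimal)
      show "col ` A \<subseteq> cfun.span (\<phi> ` P)"
        using cfun_combination_in_span[of P \<phi>] by (auto simp: col cfun.span_base)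
    qed (rule cfun.subspace_span)
    show "cfun.span (\<phi> ` P) \<subseteq> cfun.span (col ` A)"
    proof (rule cfun.span_minimal)
      show "\<phi> ` P \<subseteq> cfun.span (col ` A)"
      proof clarify
        fix p assume "p \<in> P"
        then obtain c where c: "\<And>q. q \<in> P \<Longrightarrow> (\<Sum>a\<in>A. c a * x a q) = (if q = p then 1 else 0)"
          using sp unfolding spanning_def by blast
        have "(\<Sum>b\<in>A. c b * col b a) = \<phi> p a" for a
        proof -
          have "(\<Sum>b\<in>A. c b * col b a) = (\<Sum>b\<in>A. \<Sum>q\<in>P. c b * x b q * \<phi> q a)"
            by (intro sum.cong refl) (simp add: col sum_distrib_left mult.assoc)
          also have "\<dots> = (\<Sum>q\<in>P. (\<Sum>b\<in>A. c b * x b q) * \<phi> q a)"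
            by (subst sum.swap) (simp add: sum_distrib_right)
          also have "\<dots> = (\<Sum>q\<in>P. if q = p then \<phi> q a else 0)"
            by (intro sum.cong refl) (simp add: c)
          finally show ?thesis
            using \<open>p \<in> P\<close> fin(2) by (simp add: sum.delta)
        qed
        then have "\<phi> p = (\<lambda>a. \<Sum>b\<in>A. c b * col b a)"
          by auto
        then show "\<phi> p \<in> cfun.span (col ` A)"
          using cfun_combination_in_span[of A col "col ` A" c] by (simp add: cfun.span_base)
      qed
    qed (rule cfun.subspace_span)
  qed
  ultimately have "cfun.dim (col ` A) = card (\<phi> ` P)"
    by (intro cfun.dim_eq_card)
  then show ?thesis
    unfolding rank_mat_def col_def using card_image[OF inj] by simp
qed

text \<open>The columns lie in the span of the \<open>card P\<close> functions
  \<open>\<phi> p\<close>, so a rank of \<open>card P\<close> leaves no slack: a basis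
  \<open>B\<close> of the column space spans every \<open>\<phi> p\<close>, and the
  \<open>\<phi> p\<close> are independent. Expanding \<open>\<phi> p\<close> in columns and
  comparing coefficients gives the required combination. Applied to Gram vectors taken from a larger
  index set, this is how flatness is exploited.\<close>

lemma spanning_if_rank:
  fixes M :: "'a \<Rightarrow> 'a \<Rightarrow> complex"
  assumes fin: "finite A" "finite P"
    and gram: "\<And>a b. a \<in> A \<Longrightarrow> b \<in> A \<Longrightarrow> M a b = cinner P (x a) (x b)"
    and rank: "rank_mat A M = card P"
  shows "spanning A P x"
proof -
  define \<phi> where "\<phi> = (\<lambda>q a. if a \<in> A then cnj (x a q) else 0)"
  define col where "col = (\<lambda>b a. if a \<in> A then M a b else 0)"
  have col: "col b = (\<lambda>a. \<Sum>q\<in>P. x b q * \<phi> q a)" if "b \<in> A" for b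
    using that gram unfolding col_def \<phi>_def cinner_def by (auto simp: fun_eq_iff mult.commute)
  obtain B where B: "B \<subseteq> col ` A" "cfun.independent B" "col ` A \<subseteq> cfun.span B" "card B = card P"
    using cfun.basis_exists[of "col ` A"] rank[unfolded rank_mat_def, folded col_def] by auto
  have "finite B"
    using B(1) fin(1) finite_subset by blast
  have col_span: "col ` A \<subseteq> cfun.span (\<phi> ` P)"
    using cfun_combination_in_span[of P \<phi>] by (auto simp: col cfun.span_base)
  have card_le: "card S \<le> card Q"
    if "cfun.independent S" "S \<subseteq> cfun.span (\<phi> ` Q)" "Q \<subseteq> P" for S Q
    using cfun.independent_span_bound[OF _ that(1,2)] card_image_le[of Q \<phi>] that(3) fin(2)
    by (meson finite_imageI finite_subset order_trans)
  have span: "\<phi> p \<in> cfun.span (col ` A)" if "p \<in> P" for p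
  proof -
    have "\<phi> p \<in> cfun.span B"
    proof (rule ccontr)
      assume no: "\<phi> p \<notin> cfun.span B"
      then have "cfun.independent (insert (\<phi> p) B)"
        using B(2) by (simp add: cfun.independent_insert)
      moreover have "insert (\<phi> p) B \<subseteq> cfun.span (\<phi> ` P)"
        using B(1) col_span that by (auto intro: cfun.span_base)
      ultimately have "card (insert (\<phi> p) B) \<le> card P"
        by (rule card_le) simp
      moreover have "\<phi> p \<notin> B"
        using no cfun.span_base by blast
      ultimately show False
        using B(4) \<open>finite B\<close> by simp
    qed
    then show ?thesis
      using cfun.span_mono[OF B(1)] by blast
  qed
  have indep: "u p = 0" if u: "\<And>a. (\<Sum>q\<in>P. u q * \<phi> q a) = 0" and p: "p \<in> P" for u p
  proof (rule ccontr)
    assume ne: "u p \<noteq> 0"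
    \<comment> \<open>A nontrivial relation would put \<open>\<phi> p\<close>, hence all of
      \<open>B\<close>, into the span of \<open>card P - 1\<close> functions, too few for
      \<open>card P\<close> independent vectors.\<close>
    have "\<phi> p a = (\<Sum>q\<in>P - {p}. (- u q / u p) * \<phi> q a)" for a
    proof -
      have "(\<Sum>q\<in>P. u q * \<phi> q a) = u p * \<phi> p a + (\<Sum>q\<in>P - {p}. u q * \<phi> q a)"
        using fin(2) p by (rule sum.remove)
      then have "\<phi> p a = - (\<Sum>q\<in>P - {p}. u q * \<phi> q a) / u p"
        using u[of a] ne by (simp add: field_simps add_eq_0_iff)
      then show ?thesis
        by (simp add: sum_divide_distrib flip: sum_negf)
    qed
    then have "\<phi> p = (\<lambda>a. \<Sum>q\<in>P - {p}. (- u q / u p) * \<phi> q a)"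
      by blast
    then have p_span: "\<phi> p \<in> cfun.span (\<phi> ` (P - {p}))"
      using cfun_combination_in_span[of "P - {p}" \<phi> "\<phi> ` (P - {p})" "\<lambda>q. - u q / u p"]
      by (simp add: cfun.span_base)
    have "\<phi> ` P \<subseteq> cfun.span (\<phi> ` (P - {p}))"
    proof clarify
      fix q assume "q \<in> P"
      then show "\<phi> q \<in> cfun.span (\<phi> ` (P - {p}))"
        using p_span by (cases "q = p") (auto intro: cfun.span_base)
    qed
    then have "cfun.span (\<phi> ` P) \<subseteq> cfun.span (\<phi> ` (P - {p}))"
      by (intro cfun.span_minimal cfun.subspace_span)
    then have "B \<subseteq> cfun.span (\<phi> ` (P - {p}))"
      using B(1) col_span by blast
    then have "card P \<le> card (P - {p})"
      using card_le[OF B(2), of "P - {p}"] B(4) by auto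
    then show False
      using p fin(2) by (metis card_Diff1_less not_less)
  qed
  show ?thesis
    unfolding spanning_def
  proof
    fix p assume p: "p \<in> P"
    obtain c where c: "\<phi> p = (\<lambda>a. \<Sum>b\<in>A. c b * col b a)"
      using cfun_span_image[OF fin(1) span[OF p]] by blast
    \<comment> \<open>The difference of two coordinate vectors of \<open>\<phi> p\<close>: the one
      that comes from its expansion in columns, and the unit vector at \<open>p\<close>.\<close>
    let ?u = "\<lambda>q. (\<Sum>b\<in>A. c b * x b q) - (if q = p then 1 else 0)"
    have "(\<Sum>q\<in>P. ?u q * \<phi> q a) = 0" for a
    proof -
      have "(\<Sum>q\<in>P. ?u q * \<phi> q a) =
          (\<Sum>q\<in>P. (\<Sum>b\<in>A. c b * x b q) * \<phi> q a) - (\<Sum>q\<in>P. if q = p then \<phi> q a else 0)"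
        unfolding sum_subtractf[symmetric] by (intro sum.cong refl) (simp add: left_diff_distrib)
      also have "(\<Sum>q\<in>P. (\<Sum>b\<in>A. c b * x b q) * \<phi> q a) = (\<Sum>b\<in>A. \<Sum>q\<in>P. c b * x b q * \<phi> q a)"
        by (subst sum.swap) (simp add: sum_distrib_right)
      also have "\<dots> = (\<Sum>b\<in>A. c b * col b a)"
        by (intro sum.cong refl) (simp add: col sum_distrib_left mult.assoc)
      finally show ?thesis
        using p fin(2) c by (simp add: sum.delta)
    qed
    then have "\<forall>q\<in>P. ?u q = 0"
      using indep[of ?u] by blast
    then show "\<exists>c. \<forall>q\<in>P. (\<Sum>a\<in>A. c a * x a q) = (if q = p then 1 else 0)"
      by (intro exI[of _ c]) auto
  qed
qed

subsection \<open>Families of commuting normal operators\<close>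

text \<open>Vectors over \<open>P\<close> are total functions extended by zero. Equality on
  \<open>P\<close> then is equality of functions, and span and subspace are available from the space
  \<open>cfun\<close> of all functions.\<close>

definition carrier_fun :: "'p set \<Rightarrow> ('p \<Rightarrow> complex) set" where
  "carrier_fun P = {u. \<forall>p. p \<notin> P \<longrightarrow> u p = 0}"

definition mat_apply :: "'p set \<Rightarrow> ('p \<Rightarrow> 'p \<Rightarrow> complex) \<Rightarrow> ('p \<Rightarrow> complex) \<Rightarrow> 'p \<Rightarrow> complex" where
  "mat_apply P T u = (\<lambda>p. if p \<in> P then \<Sum>q\<in>P. T p q * u q else 0)"

definition mat_adj :: "('p \<Rightarrow> 'p \<Rightarrow> complex) \<Rightarrow> 'p \<Rightarrow> 'p \<Rightarrow> complex" where
  "mat_adj T p q = cnj (T q p)"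

lemma mat_apply_carrier: "mat_apply P T u \<in> carrier_fun P"
  unfolding mat_apply_def carrier_fun_def by simp

lemma mat_apply_add: "mat_apply P T (\<lambda>p. u p + v p) = (\<lambda>p. mat_apply P T u p + mat_apply P T v p)"
  unfolding mat_apply_def by (auto simp: fun_eq_iff distrib_left sum.distrib)

lemma mat_apply_scale: "mat_apply P T (\<lambda>p. c * u p) = (\<lambda>p. c * mat_apply P T u p)"
  unfolding mat_apply_def by (auto simp: fun_eq_iff sum_distrib_left mult_ac)

lemma mat_apply_sum:
  "mat_apply P T (\<lambda>p. \<Sum>i\<in>I. f i p) = (\<lambda>p. \<Sum>i\<in>I. mat_apply P T (f i) p)"
  unfolding mat_apply_def sum_distrib_left
  by (rule ext, subst sum.swap) simp

lemma cinner_mat_apply_left: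
  "cinner P (mat_apply P T u) v = cinner P u (mat_apply P (mat_adj T) v)"
proof -
  have "cinner P (mat_apply P T u) v = (\<Sum>p\<in>P. \<Sum>q\<in>P. cnj (T p q) * cnj (u q) * v p)"
    unfolding cinner_def mat_apply_def by (intro sum.cong refl) (simp add: sum_distrib_right)
  also have "\<dots> = (\<Sum>q\<in>P. \<Sum>p\<in>P. cnj (T p q) * cnj (u q) * v p)"
    by (rule sum.swap)
  also have "\<dots> = cinner P u (mat_apply P (mat_adj T) v)"
    unfolding cinner_def mat_apply_def mat_adj_def
    by (intro sum.cong refl) (simp add: sum_distrib_left mult_ac)
  finally show ?thesis .
qed

lemma cinner_mat_apply_right:
  "cinner P u (mat_apply P T v) = cinner P (mat_apply P (mat_adj T) u) v"
  using cinner_mat_apply_left[of P T v u] by (metis cinner_commute)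

lemma cinner_sum_left: "cinner P (\<lambda>p. \<Sum>i\<in>I. f i p) v = (\<Sum>i\<in>I. cinner P (f i) v)"
  unfolding cinner_def cnj_sum sum_distrib_right by (rule sum.swap)

lemma cinner_sum_right: "cinner P v (\<lambda>p. \<Sum>i\<in>I. f i p) = (\<Sum>i\<in>I. cinner P v (f i))"
  unfolding cinner_def sum_distrib_left by (rule sum.swap)

lemma carrier_eq_iff:
  "u \<in> carrier_fun P \<Longrightarrow> v \<in> carrier_fun P \<Longrightarrow> u = v \<longleftrightarrow> (\<forall>p\<in>P. u p = v p)"
  unfolding carrier_fun_def by (auto simp: fun_eq_iff)

text \<open>
  The assumption is positivity of the form that the block matrix of condition 3 defines. Its Schur
  complement has the blocks \<open>T l^* T k - T k T l^*\<close>; it is positive semidefinite with trace zero.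
\<close>

lemma jointly_hyponormal_imp_commute:
  fixes T :: "'k \<Rightarrow> 'p \<Rightarrow> 'p \<Rightarrow> complex"
  assumes fin: "finite P" "finite I"
    and pos: "\<And>X0 X. 0 \<le> Re (cinner P X0 X0
        + (\<Sum>k\<in>I. cinner P (mat_apply P (T k) X0) (X k) + cinner P (X k) (mat_apply P (T k) X0))
        + (\<Sum>k\<in>I. \<Sum>l\<in>I. cinner P (mat_apply P (T l) (X k)) (mat_apply P (T k) (X l))))"
    and "k \<in> I" "l \<in> I" "p \<in> P" "q \<in> P"
  shows "(\<Sum>s\<in>P. cnj (T l s p) * T k s q) = (\<Sum>s\<in>P. T k p s * cnj (T l q s))"
proof -
  define E where "E = (\<lambda>(k, p) (l, q).
      (\<Sum>s\<in>P. cnj (T l s p) * T k s q) - (\<Sum>s\<in>P. T k p s * cnj (T l q s)))"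
  have "psd_mat (I \<times> P) E"
    unfolding psd_mat_def
  proof (intro conjI ballI allI)
    fix a b
    show "E b a = cnj (E a b)"
      unfolding E_def by (simp split: prod.split add: mult.commute)
  next
    fix v :: "'k \<times> 'p \<Rightarrow> complex"
    define X where "X = (\<lambda>k p. v (k, p))"
    define W where "W = (\<lambda>p. \<Sum>k\<in>I. mat_apply P (mat_adj (T k)) (X k) p)"
    \<comment> \<open>For fixed \<open>X\<close> the form is the squared norm of \<open>X0\<close>,
      plus twice the real part of the inner product of \<open>X0\<close> and \<open>W\<close>, plus
      terms free of \<open>X0\<close>. It is minimal at \<open>- W\<close>, and the minimum is the
      form of the Schur complement.\<close>
    define X0 where "X0 = (\<lambda>p. (-1) * W p)"
    have WW: "cinner P W W = (\<Sum>k\<in>I. \<Sum>l\<in>I.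
        cinner P (mat_apply P (mat_adj (T k)) (X k)) (mat_apply P (mat_adj (T l)) (X l)))"
      unfolding W_def cinner_sum_left cinner_sum_right ..
    have "(\<Sum>k\<in>I. cinner P (mat_apply P (T k) X0) (X k) + cinner P (X k) (mat_apply P (T k) X0))
        = cinner P X0 W + cinner P W X0"
      unfolding sum.distrib cinner_mat_apply_left[of P _ X0] cinner_mat_apply_right[of P _ _ X0]
      by (simp add: W_def cinner_sum_left cinner_sum_right)
    then have "cinner P X0 X0
        + (\<Sum>k\<in>I. cinner P (mat_apply P (T k) X0) (X k) + cinner P (X k) (mat_apply P (T k) X0))
        = - cinner P W W"
      unfolding X0_def cinner_scale_left cinner_scale_right by simp
    moreover have "(\<Sum>a\<in>I \<times> P. \<Sum>b\<in>I \<times> P. cnj (v a) * E a b * v b)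
        = (\<Sum>k\<in>I. \<Sum>l\<in>I. cinner P (mat_apply P (T l) (X k)) (mat_apply P (T k) (X l))) - cinner P W W"
    proof -
      have form: "(\<Sum>p\<in>P. \<Sum>q\<in>P. cnj (v (k, p)) * E (k, p) (l, q) * v (l, q)) =
          cinner P (mat_apply P (T l) (X k)) (mat_apply P (T k) (X l)) -
          cinner P (mat_apply P (mat_adj (T k)) (X k)) (mat_apply P (mat_adj (T l)) (X l))" for k l
      proof -
        have 1: "cinner P (mat_apply P (T l) (X k)) (mat_apply P (T k) (X l)) =
            (\<Sum>p\<in>P. \<Sum>q\<in>P. cnj (X k p) * cinner P (\<lambda>s. T l s p) (\<lambda>s. T k s q) * X l q)"
          unfolding cinner_combination[symmetric]
          by (intro cinner_cong) (simp_all add: mat_apply_def mult.commute)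
        have 2: "cinner P (mat_apply P (mat_adj (T k)) (X k)) (mat_apply P (mat_adj (T l)) (X l)) =
            (\<Sum>p\<in>P. \<Sum>q\<in>P. cnj (X k p) * cinner P (\<lambda>s. cnj (T k p s)) (\<lambda>s. cnj (T l q s)) * X l q)"
          unfolding cinner_combination[symmetric]
          by (intro cinner_cong) (simp_all add: mat_apply_def mat_adj_def mult.commute)
        show ?thesis
          unfolding 1 2 sum_subtractf[symmetric]
          unfolding E_def cinner_def X_def
          by (intro sum.cong refl) (simp add: algebra_simps)
      qed
      have "(\<Sum>a\<in>I \<times> P. \<Sum>b\<in>I \<times> P. cnj (v a) * E a b * v b) =
          (\<Sum>k\<in>I. \<Sum>p\<in>P. \<Sum>l\<in>I. \<Sum>q\<in>P. cnj (v (k, p)) * E (k, p) (l, q) * v (l, q))"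
        unfolding sum.cartesian_product' ..
      also have "\<dots> = (\<Sum>k\<in>I. \<Sum>l\<in>I. \<Sum>p\<in>P. \<Sum>q\<in>P. cnj (v (k, p)) * E (k, p) (l, q) * v (l, q))"
        by (intro sum.cong refl sum.swap)
      finally show ?thesis
        unfolding form WW sum_subtractf .
    qed
    ultimately show "0 \<le> Re (\<Sum>a\<in>I \<times> P. \<Sum>b\<in>I \<times> P. cnj (v a) * E a b * v b)"
      using pos[of X0 X] by simp
  qed
  moreover have "(\<Sum>a\<in>I \<times> P. E a a) = 0"
  proof -
    \<comment> \<open>A diagonal block is a self-commutator; both of its products have the squared
      Frobenius norm of \<open>T k\<close> as trace.\<close>
    have "(\<Sum>p\<in>P. E (k, p) (k, p)) = 0" for k
      unfolding E_def by (simp add: sum_subtractf mult.commute) (rule sum.swap)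
    then show ?thesis
      unfolding sum.cartesian_product' by simp
  qed
  ultimately have "E (k, p) (l, q) = 0"
    using psd_mat_trace_0[of "I \<times> P" E "(k, p)" "(l, q)"] assms by simp
  then show ?thesis
    unfolding E_def by simp
qed

section \<open>Annihilating polynomials and semisimple operators\<close>

definition op_poly :: "(('p \<Rightarrow> complex) \<Rightarrow> 'p \<Rightarrow> complex) \<Rightarrow> complex poly \<Rightarrow> ('p \<Rightarrow> complex) \<Rightarrow> 'p \<Rightarrow> complex"
  where "op_poly N p u = (\<lambda>a. \<Sum>i\<le>degree p. coeff p i * (N ^^ i) u a)"

lemma op_poly_altdef:
  assumes "degree p \<le> n"
  shows "op_poly N p u a = (\<Sum>i\<le>n. coeff p i * (N ^^ i) u a)"
  unfolding op_poly_def using assms by (intro sum.mono_neutral_left) (auto simp: coeff_eq_0)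

text \<open>This is how splitting off a root lowers the degree: if \<open>[:- z, 1:] * q\<close>
  annihilates \<open>u\<close>, then \<open>q\<close> annihilates \<open>(N - z) u\<close>.
  Multiplication by the variable is a shift of the summation index.\<close>

lemma op_poly_linear_factor:
  assumes add: "\<And>u v. N (\<lambda>a. u a + v a) = (\<lambda>a. N u a + N v a)"
    and scale: "\<And>c u. N (\<lambda>a. c * u a) = (\<lambda>a. c * N u a)"
  shows "op_poly N ([:- z, 1:] * q) u = op_poly N q (\<lambda>a. N u a - z * u a)"
proof
  fix a
  have pow: "(N ^^ i) (\<lambda>a. N u a - z * u a) = (\<lambda>a. (N ^^ Suc i) u a - z * (N ^^ i) u a)" for i
  proof (induction i)
    case (Suc i)
    have diff: "N (\<lambda>a. f a - c * h a) = (\<lambda>a. N f a - c * N h a)" for f h c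
      using add[of f "\<lambda>a. (- c) * h a"] scale[of "- c" h] by simp
    show ?case
      unfolding funpow.simps(2) comp_def Suc diff ..
  qed auto
  let ?n = "degree q"
  have "degree ([:- z, 1:] * q) \<le> Suc ?n"
    using degree_mult_le[of "[:- z, 1:]" q] by simp
  then have "op_poly N ([:- z, 1:] * q) u a =
      (\<Sum>i\<le>Suc ?n. coeff ([:- z, 1:] * q) i * (N ^^ i) u a)"
    by (rule op_poly_altdef)
  also have "\<dots> = (\<Sum>i\<le>Suc ?n. coeff (pCons 0 q) i * (N ^^ i) u a) -
      (\<Sum>i\<le>Suc ?n. z * coeff q i * (N ^^ i) u a)"
    unfolding sum_subtractf[symmetric] by (intro sum.cong refl) (simp add: algebra_simps)
  also have "(\<Sum>i\<le>Suc ?n. coeff (pCons 0 q) i * (N ^^ i) u a) =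
      (\<Sum>i\<le>?n. coeff q i * (N ^^ Suc i) u a)"
    unfolding sum.atMost_Suc_shift by simp
  also have "(\<Sum>i\<le>Suc ?n. z * coeff q i * (N ^^ i) u a) = (\<Sum>i\<le>?n. z * coeff q i * (N ^^ i) u a)"
    by (simp add: coeff_eq_0)
  also have "(\<Sum>i\<le>?n. coeff q i * (N ^^ Suc i) u a) - (\<Sum>i\<le>?n. z * coeff q i * (N ^^ i) u a) =
      op_poly N q (\<lambda>a. N u a - z * u a) a"
    unfolding op_poly_def pow sum_subtractf[symmetric]
    by (intro sum.cong refl) (simp add: algebra_simps)
  finally show "op_poly N ([:- z, 1:] * q) u a = op_poly N q (\<lambda>a. N u a - z * u a) a" .
qed

text \<open>The \<open>card B + 1\<close> iterates with exponents up to \<open>card B\<close> lie in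
  the span of \<open>card B\<close> vectors, so a nontrivial combination of them vanishes.\<close>

lemma annihilating_poly_exists:
  assumes "finite B" "\<And>i. (N ^^ i) u \<in> cfun.span B"
  shows "\<exists>p. p \<noteq> 0 \<and> op_poly N p u = 0"
proof -
  let ?n = "card B"
  let ?f = "\<lambda>i. (N ^^ i) u"
  have "\<exists>c. (\<exists>i\<le>?n. c i \<noteq> 0) \<and> (\<forall>a. (\<Sum>i\<le>?n. c i * ?f i a) = 0)"
  \<comment> \<open>Dependence in \<open>cfun\<close> is a property of sets: equal iterates collapse
    to one element, so in that case their difference serves as the relation.\<close>
  proof (cases "inj_on ?f {..?n}")
    case False
    then obtain i j where ij: "i \<le> ?n" "j \<le> ?n" "i \<noteq> j" "?f i = ?f j"
      unfolding inj_on_def by auto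
    let ?c = "\<lambda>s. (if s = i then 1 else 0) - (if s = j then 1 else 0) :: complex"
    have "(\<Sum>s\<le>?n. ?c s * ?f s a) = 0" for a
    proof -
      have "(\<Sum>s\<le>?n. ?c s * ?f s a) =
          (\<Sum>s\<le>?n. if s = i then ?f s a else 0) - (\<Sum>s\<le>?n. if s = j then ?f s a else 0)"
        unfolding sum_subtractf[symmetric] by (intro sum.cong refl) auto
      then show ?thesis
        using ij by (simp add: sum.delta)
    qed
    then show ?thesis
      using ij by (intro exI[of _ ?c]) auto
  next
    case True
    have "cfun.dependent (?f ` {..?n})"
    proof (rule ccontr)
      assume "\<not> ?thesis"
      then have "card (?f ` {..?n}) \<le> card B"
        using cfun.independent_span_bound[OF assms(1)] assms(2) by blast
      then show False
        using card_image[OF True] by simp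
    qed
    then obtain w where w: "\<exists>v\<in>?f ` {..?n}. w v \<noteq> 0" "(\<Sum>v\<in>?f ` {..?n}. (\<lambda>a. w v * v a)) = 0"
      unfolding cfun.dependent_finite[OF finite_imageI[OF finite_atMost]] by blast
    have "(\<Sum>i\<le>?n. w (?f i) * ?f i a) = 0" for a
      using fun_cong[OF w(2), of a] unfolding sum_fun_apply by (simp add: sum.reindex[OF True])
    then show ?thesis
      using w(1) by (intro exI[of _ "\<lambda>i. w (?f i)"]) auto
  qed
  then obtain c i0 where c: "i0 \<le> ?n" "c i0 \<noteq> 0" "\<And>a. (\<Sum>i\<le>?n. c i * ?f i a) = 0"
    by blast
  define p where "p = (\<Sum>i\<le>?n. monom (c i) i)"
  have coeff: "coeff p i = (if i \<le> ?n then c i else 0)" for i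
    unfolding p_def coeff_sum by (simp add: sum.delta)
  have "p \<noteq> 0"
    using coeff[of i0] c by auto
  moreover have "degree p \<le> ?n"
    by (rule degree_le) (simp add: coeff)
  then have "op_poly N p u = 0"
    using c(3) by (auto simp: fun_eq_iff op_poly_altdef coeff)
  ultimately show ?thesis
    by blast
qed

text \<open>
  Induction on the degree of a polynomial \<open>p\<close> with \<open>p(N) u = 0\<close>: splitting off a root \<open>z\<close>, the vector
  \<open>(N - z) u\<close> is a sum of eigenvectors; those for eigenvalues other than \<open>z\<close> lie in the image of \<open>N - z\<close>,
  and what remains is killed by \<open>(N - z)^2\<close>.
\<close>

lemma semisimple_span_eigenvectors:
  assumes add: "\<And>u v. N (\<lambda>a. u a + v a) = (\<lambda>a. N u a + N v a)"
    and scale: "\<And>c u. N (\<lambda>a. c * u a) = (\<lambda>a. c * N u a)"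
    and W: "cfun.subspace W" "finite B" "W \<subseteq> cfun.span B"
    and inv: "\<And>u. u \<in> W \<Longrightarrow> N u \<in> W"
    and semi: "\<And>z u w. u \<in> W \<Longrightarrow> w = (\<lambda>a. N u a - z * u a) \<Longrightarrow> N w = (\<lambda>a. z * w a) \<Longrightarrow> w = 0"
  shows "W \<subseteq> cfun.span {u \<in> W. \<exists>z. N u = (\<lambda>a. z * u a)}" (is "_ \<subseteq> cfun.span ?E")
proof
  have EW: "cfun.span ?E \<subseteq> W"
    by (rule cfun.span_minimal) (use W(1) in auto)
  have diff: "N (\<lambda>a. u a - v a) = (\<lambda>a. N u a - N v a)" for u v
    using add[of u "\<lambda>a. (- 1) * v a"] scale[of "- 1" v] by simp
  have zero: "N (\<lambda>a. 0) = (\<lambda>a. 0)"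
    using scale[of 0 "\<lambda>a. 0"] by simp
  have shift: "(\<lambda>a. N u a - z * u a) \<in> W" if "u \<in> W" for u z
  proof -
    have "N u - (\<lambda>a. z * u a) \<in> W"
      using W(1) inv that by (intro cfun.subspace_diff cfun.subspace_scale) auto
    then show ?thesis
      by (simp add: fun_diff_def)
  qed
  have split: "\<exists>s\<in>cfun.span ?E. N (\<lambda>a. w a - (N s a - z * s a)) = (\<lambda>a. z * (w a - (N s a - z * s a)))"
    if "w \<in> cfun.span ?E" for w z
  proof -
    let ?S = "{w. \<exists>s\<in>cfun.span ?E.
        N (\<lambda>a. w a - (N s a - z * s a)) = (\<lambda>a. z * (w a - (N s a - z * s a)))}"
    have "cfun.subspace ?S"
    proof (rule cfun.subspaceI)
      show "0 \<in> ?S"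
        using cfun.span_zero[of ?E] by (intro CollectI bexI[of _ 0]) (auto simp: zero_fun_def zero)
    next
      fix v w assume "v \<in> ?S" "w \<in> ?S"
      then obtain s t where st: "s \<in> cfun.span ?E" "t \<in> cfun.span ?E"
        and s: "N (\<lambda>a. v a - (N s a - z * s a)) = (\<lambda>a. z * (v a - (N s a - z * s a)))"
        and t: "N (\<lambda>a. w a - (N t a - z * t a)) = (\<lambda>a. z * (w a - (N t a - z * t a)))"
        by blast
      have eq: "(\<lambda>a. (v + w) a - (N (s + t) a - z * (s + t) a)) =
          (\<lambda>a. (v a - (N s a - z * s a)) + (w a - (N t a - z * t a)))"
        unfolding plus_fun_def add by (simp add: algebra_simps)
      have eq': "(\<lambda>a. z * ((v + w) a - (N (s + t) a - z * (s + t) a))) =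
          (\<lambda>a. z * (v a - (N s a - z * s a)) + z * (w a - (N t a - z * t a)))"
        by (rule ext) (use fun_cong[OF eq] in \<open>simp only: distrib_left[symmetric]\<close>)
      have "N (\<lambda>a. (v + w) a - (N (s + t) a - z * (s + t) a)) =
          (\<lambda>a. z * ((v + w) a - (N (s + t) a - z * (s + t) a)))"
        unfolding eq eq' add s t ..
      then show "v + w \<in> ?S"
        using st by (intro CollectI bexI[of _ "s + t"] cfun.span_add)
    next
      fix c w assume "w \<in> ?S"
      then obtain s where st: "s \<in> cfun.span ?E"
        and s: "N (\<lambda>a. w a - (N s a - z * s a)) = (\<lambda>a. z * (w a - (N s a - z * s a)))"
        by blast
      let ?s = "\<lambda>a. c * s a"
      have eq: "(\<lambda>a. c * w a - (N ?s a - z * ?s a)) = (\<lambda>a. c * (w a - (N s a - z * s a)))"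
        unfolding scale by (simp add: algebra_simps)
      have eq': "(\<lambda>a. z * (c * w a - (N ?s a - z * ?s a))) = (\<lambda>a. c * (z * (w a - (N s a - z * s a))))"
        by (rule ext) (use fun_cong[OF eq] in \<open>simp only: mult.left_commute[of c]\<close>)
      have "N (\<lambda>a. c * w a - (N ?s a - z * ?s a)) = (\<lambda>a. z * (c * w a - (N ?s a - z * ?s a)))"
        unfolding eq eq' unfolding scale s ..
      then show "(\<lambda>a. c * w a) \<in> ?S"
        using cfun.span_scale[OF st, of c] by blast
    qed
    moreover have "?E \<subseteq> ?S"
    proof clarify
      fix w z' assume w: "w \<in> W" "N w = (\<lambda>a. z' * w a)"
      show "\<exists>s\<in>cfun.span ?E. N (\<lambda>a. w a - (N s a - z * s a)) = (\<lambda>a. z * (w a - (N s a - z * s a)))"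
      proof (cases "z' = z")
        case True
        then show ?thesis
          using w cfun.span_zero[of ?E] by (intro bexI[of _ 0]) (auto simp: zero_fun_def zero)
      next
        case False
        \<comment> \<open>On this eigenvector \<open>N - z\<close> is multiplication by
          \<open>z' - z\<close>, so division by that number gives a preimage of
          \<open>w\<close>.\<close>
        let ?s = "\<lambda>a. (1 / (z' - z)) * w a"
        have "N ?s a - z * ?s a = w a" for a
        proof -
          have "i * (z' * b) - z * (i * b) = i * (z' - z) * b" for i b :: complex
            by (simp add: algebra_simps)
          from this[of "1 / (z' - z)"] show ?thesis
            unfolding scale w(2) using False by simp
        qed
        moreover have "?s \<in> cfun.span ?E"
          using w by (intro cfun.span_scale cfun.span_base) blast
        ultimately show ?thesis
          by (intro bexI[of _ ?s]) (simp_all add: zero)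
      qed
    qed
    ultimately have "cfun.span ?E \<subseteq> ?S"
      by (intro cfun.span_minimal)
    then show ?thesis
      using that by blast
  qed
  have main: "u \<in> cfun.span ?E" if "p \<noteq> 0" "u \<in> W" "op_poly N p u = 0" for p u
    using that
  proof (induction "degree p" arbitrary: p u)
    case 0
    then obtain c where "p = [:c:]" "c \<noteq> 0"
      by (metis degree_eq_zeroE pCons_0_0)
    then have "u = 0"
      using 0(4) by (auto simp: op_poly_def fun_eq_iff)
    then show ?case
      by (simp only: cfun.span_zero)
  next
    case (Suc n)
    have "\<not> constant (poly p)"
      using Suc.hyps(2) by (simp add: constant_degree)
    then obtain z where "poly p z = 0"
      using fundamental_theorem_of_algebra by blast
    then obtain q where q: "p = [:- z, 1:] * q"
      unfolding poly_eq_0_iff_dvd by (auto elim: dvdE)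
    have "q \<noteq> 0"
      using q Suc.prems(1) by auto
    then have "degree p = Suc (degree q)"
      unfolding q by (subst degree_mult_eq) auto
    then have deg: "n = degree q"
      using Suc.hyps(2) by simp
    let ?w = "\<lambda>a. N u a - z * u a"
    have "?w \<in> cfun.span ?E"
      using Suc.hyps(1)[OF deg \<open>q \<noteq> 0\<close> shift[OF Suc.prems(2)]] Suc.prems(3)
      unfolding q op_poly_linear_factor[of N, OF add scale] by blast
    then obtain s where s: "s \<in> cfun.span ?E"
      "N (\<lambda>a. ?w a - (N s a - z * s a)) = (\<lambda>a. z * (?w a - (N s a - z * s a)))"
      using split by blast
    let ?v = "\<lambda>a. u a - s a"
    have "u - s \<in> W"
      using W(1) Suc.prems(2) s(1) EW by (intro cfun.subspace_diff) auto
    then have vW: "?v \<in> W"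
      by (simp add: fun_diff_def)
    have eq: "(\<lambda>a. ?w a - (N s a - z * s a)) = (\<lambda>a. N ?v a - z * ?v a)"
      unfolding diff by (simp add: algebra_simps)
    \<comment> \<open>By the choice of \<open>s\<close>, the vector \<open>(N - z) v\<close> is
      itself killed by \<open>N - z\<close>; then \<open>semi\<close> makes it zero, which leaves
      \<open>v\<close> in the eigenspace of \<open>z\<close>.\<close>
    have "(\<lambda>a. N ?v a - z * ?v a) = 0"
      using semi[OF vW refl] s(2) unfolding fun_cong[OF eq] eq by blast
    then have "N ?v = (\<lambda>a. z * ?v a)"
      by (simp add: fun_eq_iff)
    then have "?v \<in> cfun.span ?E"
      using vW by (intro cfun.span_base) blast
    then have "?v + s \<in> cfun.span ?E"
      using s(1) by (rule cfun.span_add)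
    then show ?case
      by (simp add: plus_fun_def)
  qed
  fix u assume u: "u \<in> W"
  have "(N ^^ i) u \<in> W" for i
    by (induction i) (auto simp: u inv)
  then obtain p where "p \<noteq> 0" "op_poly N p u = 0"
    using annihilating_poly_exists[OF W(2) subsetD[OF W(3)]] by metis
  from main[OF this(1) u this(2)] show "u \<in> cfun.span ?E" .
qed

section \<open>Joint diagonalization of a normal family\<close>

lemma carrier_fun_subspace: "cfun.subspace (carrier_fun P)"
  by (rule cfun.subspaceI) (auto simp: carrier_fun_def zero_fun_def plus_fun_def)

lemma carrier_fun_span:
  assumes "finite P"
  shows "carrier_fun P \<subseteq> cfun.span ((\<lambda>p q. if q = p then 1 else 0) ` P)"
proof
  fix u assume u: "u \<in> carrier_fun P"
  let ?e = "\<lambda>p q. if q = p then 1 else 0 :: complex"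
  have "(\<Sum>p\<in>P. u p * ?e p q) = u q" for q
    using u assms by (auto simp: carrier_fun_def if_distrib if_distribR sum.delta cong: if_cong)
  then have "u = (\<lambda>q. \<Sum>p\<in>P. u p * ?e p q)"
    by auto
  then show "u \<in> cfun.span (?e ` P)"
    using cfun_combination_in_span[of P ?e "?e ` P" u] by (simp add: cfun.span_base)
qed

text \<open>\<open>adj_commute\<close> is the entrywise form of the adjoint of \<open>T l\<close>
  commuting with \<open>T k\<close>; the case \<open>k = l\<close> is normality. That the
  \<open>T k\<close> commute with one another is derived in \<open>app_commute\<close>.\<close>

locale normal_family =
  fixes P :: "'p set" and T :: "'k \<Rightarrow> 'p \<Rightarrow> 'p \<Rightarrow> complex"
  assumes fin: "finite P"
    and adj_commute: "\<And>k l p q. p \<in> P \<Longrightarrow> q \<in> P \<Longrightarrow>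
      (\<Sum>s\<in>P. cnj (T l s p) * T k s q) = (\<Sum>s\<in>P. T k p s * cnj (T l q s))"
begin

abbreviation app :: "'k \<Rightarrow> ('p \<Rightarrow> complex) \<Rightarrow> 'p \<Rightarrow> complex" where
  "app k \<equiv> mat_apply P (T k)"

abbreviation adj :: "'k \<Rightarrow> ('p \<Rightarrow> complex) \<Rightarrow> 'p \<Rightarrow> complex" where
  "adj k \<equiv> mat_apply P (mat_adj (T k))"

lemma adj_app: "adj l (app k u) = app k (adj l u)"
proof
  fix p
  show "adj l (app k u) p = app k (adj l u) p"
  proof (cases "p \<in> P")
    case True
    have "adj l (app k u) p = (\<Sum>s\<in>P. \<Sum>q\<in>P. cnj (T l s p) * T k s q * u q)"
      using True by (simp add: mat_apply_def mat_adj_def sum_distrib_left mult.assoc)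
    also have "\<dots> = (\<Sum>q\<in>P. (\<Sum>s\<in>P. cnj (T l s p) * T k s q) * u q)"
      by (subst sum.swap) (simp add: sum_distrib_right)
    also have "\<dots> = (\<Sum>q\<in>P. (\<Sum>s\<in>P. T k p s * cnj (T l q s)) * u q)"
      using True by (intro sum.cong refl) (simp add: adj_commute)
    also have "\<dots> = (\<Sum>s\<in>P. \<Sum>q\<in>P. T k p s * cnj (T l q s) * u q)"
      by (subst sum.swap) (simp add: sum_distrib_right)
    also have "\<dots> = app k (adj l u) p"
      using True by (simp add: mat_apply_def mat_adj_def sum_distrib_left mult.assoc)
    finally show ?thesis .
  qed (simp add: mat_apply_def)
qed

text \<open>By normality, \<open>T k - z\<close> and its adjoint send \<open>u\<close> to vectors of
  equal norm, so one of them vanishes exactly when the other does.\<close>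

lemma eigenvector_adj_iff:
  assumes "u \<in> carrier_fun P"
  shows "app k u = (\<lambda>p. z * u p) \<longleftrightarrow> adj k u = (\<lambda>p. cnj z * u p)"
proof -
  have expand: "cinner P (\<lambda>p. v p - c * u p) (\<lambda>p. v p - c * u p) =
      cinner P v v - c * cinner P v u - cnj c * cinner P u v + cnj c * c * cinner P u u" for v c
    by (simp add: cinner_diff_left cinner_diff_right cinner_scale_left cinner_scale_right algebra_simps)
  have "cinner P (app k u) (app k u) = cinner P (adj k u) (adj k u)"
    by (simp only: cinner_mat_apply_left[of P "T k" u "app k u"] adj_app
        cinner_mat_apply_right[of P u "T k" "adj k u"])
  moreover have "cinner P (app k u) u = cinner P u (adj k u)" "cinner P u (app k u) = cinner P (adj k u) u"
    by (rule cinner_mat_apply_left, rule cinner_mat_apply_right)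
  ultimately have "cinner P (\<lambda>p. app k u p - z * u p) (\<lambda>p. app k u p - z * u p) =
      cinner P (\<lambda>p. adj k u p - cnj z * u p) (\<lambda>p. adj k u p - cnj z * u p)"
    unfolding expand by simp
  then have "(\<forall>p\<in>P. app k u p - z * u p = 0) \<longleftrightarrow> (\<forall>p\<in>P. adj k u p - cnj z * u p = 0)"
    unfolding cinner_self_eq_0[OF fin, symmetric] by simp
  moreover have "(\<lambda>p. c * u p) \<in> carrier_fun P" for c
    using assms by (simp add: carrier_fun_def)
  ultimately show ?thesis
    using carrier_eq_iff[of "app k u" P "\<lambda>p. z * u p"]
      carrier_eq_iff[of "adj k u" P "\<lambda>p. cnj z * u p"]
    by (simp add: mat_apply_carrier)
qed

text \<open>Moving \<open>T k - z\<close> to the other side of the inner product of \<open>w\<close>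
  with itself turns it into its adjoint, which kills \<open>w\<close>. This excludes Jordan blocks
  of size 2, as \<open>semi\<close> in \<open>semisimple_span_eigenvectors\<close> asks.\<close>

lemma generalized_eigenvector_eq_0:
  assumes "u \<in> carrier_fun P" "w = (\<lambda>p. app k u p - z * u p)" "app k w = (\<lambda>p. z * w p)"
  shows "w = 0"
proof -
  have "app k u - (\<lambda>p. z * u p) \<in> carrier_fun P"
    using assms(1) by (intro cfun.subspace_diff cfun.subspace_scale carrier_fun_subspace mat_apply_carrier)
  then have w: "w \<in> carrier_fun P"
    unfolding assms(2) by (simp add: fun_diff_def)
  have "cinner P w w = cinner P u (adj k w) - cnj z * cinner P u w"
    using assms(2) cinner_diff_left[of P "app k u" "\<lambda>p. z * u p" w]
    by (simp only: cinner_scale_left cinner_mat_apply_left)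
  also have "adj k w = (\<lambda>p. cnj z * w p)"
    using eigenvector_adj_iff[OF w] assms(3) by blast
  finally have "cinner P w w = 0"
    by (simp add: cinner_scale_right)
  then have "\<forall>p\<in>P. w p = 0"
    using cinner_self_eq_0[OF fin] by blast
  then show ?thesis
    using w by (auto simp: carrier_fun_def fun_eq_iff)
qed

text \<open>Stated for invariant subspaces so that it applies inside joint eigenspaces of other
  operators. Semisimplicity passes to subspaces, so invariance under \<open>T k\<close> alone
  suffices.\<close>

lemma span_eigenvectors:
  assumes "cfun.subspace W" "W \<subseteq> carrier_fun P" "\<And>u. u \<in> W \<Longrightarrow> app k u \<in> W"
  shows "W \<subseteq> cfun.span {u \<in> W. \<exists>z. app k u = (\<lambda>a. z * u a)}"
proof (rule semisimple_span_eigenvectors)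
  show "W \<subseteq> cfun.span ((\<lambda>p q. if q = p then 1 else 0) ` P)"
    using carrier_fun_span[OF fin] assms(2) by blast
qed (use assms fin generalized_eigenvector_eq_0 in \<open>auto simp: mat_apply_add mat_apply_scale\<close>)

lemma subspace_eigenspace: "cfun.subspace {u. mat_apply P A u = (\<lambda>p. z * u p)}"
proof (rule cfun.subspaceI)
  show "0 \<in> {u. mat_apply P A u = (\<lambda>p. z * u p)}"
    using mat_apply_scale[of P A 0 0] by (simp add: zero_fun_def)
qed (auto simp: plus_fun_def mat_apply_add mat_apply_scale fun_eq_iff distrib_left)

text \<open>
  Since \<open>T k\<close> commutes with the adjoint of \<open>T l\<close>, it preserves the eigenspaces of that adjoint, which
  are the eigenspaces of \<open>T l\<close>.
\<close>

lemma app_commute: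
  assumes "u \<in> carrier_fun P"
  shows "app l (app k u) = app k (app l u)"
proof -
  let ?E = "{u \<in> carrier_fun P. \<exists>z. app l u = (\<lambda>a. z * u a)}"
  let ?S = "{u. app l (app k u) = app k (app l u)}"
  have "?E \<subseteq> ?S"
  proof clarify
    fix u z assume u: "u \<in> carrier_fun P" "app l u = (\<lambda>a. z * u a)"
    then have "adj l (app k u) = (\<lambda>p. cnj z * app k u p)"
      using eigenvector_adj_iff[OF u(1)] by (simp add: adj_app mat_apply_scale)
    then have "app l (app k u) = (\<lambda>p. z * app k u p)"
      using eigenvector_adj_iff[OF mat_apply_carrier] by blast
    then show "app l (app k u) = app k (app l u)"
      using u by (simp add: mat_apply_scale)
  qed
  moreover have "cfun.subspace ?S"
  proof (rule cfun.subspaceI)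
    show "0 \<in> ?S"
      using mat_apply_scale[of P _ 0 0] by (simp add: zero_fun_def)
  qed (auto simp: plus_fun_def mat_apply_add mat_apply_scale)
  ultimately have "cfun.span ?E \<subseteq> ?S"
    by (rule cfun.span_minimal)
  moreover have "u \<in> cfun.span ?E"
    using span_eigenvectors[of "carrier_fun P" l] assms carrier_fun_subspace mat_apply_carrier by blast
  ultimately show ?thesis
    by blast
qed

text \<open>Adding an operator \<open>T l\<close>: the joint eigenspace \<open>W\<close> of the
  earlier operators for a fixed choice of eigenvalues is invariant under \<open>T l\<close> by
  commutation, so every vector of \<open>W\<close> splits into eigenvectors of \<open>T l\<close>
  that stay in \<open>W\<close>.\<close>

lemma span_joint_eigenvectors:
  assumes "finite I"
  shows "carrier_fun P \<subseteq> cfun.span {u \<in> carrier_fun P. \<forall>k\<in>I. \<exists>z. app k u = (\<lambda>p. z * u p)}"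
  using assms
proof (induction I)
  case empty
  then show ?case
    using cfun.span_superset by auto
next
  case (insert l I)
  let ?J = "\<lambda>I. {u \<in> carrier_fun P. \<forall>k\<in>I. \<exists>z. app k u = (\<lambda>p. z * u p)}"
  have "?J I \<subseteq> cfun.span (?J (insert l I))"
  proof
    fix u assume u: "u \<in> ?J I"
    then obtain z where z: "\<And>k. k \<in> I \<Longrightarrow> app k u = (\<lambda>p. z k * u p)"
      by (simp add: Ball_def) metis
    define W where "W = carrier_fun P \<inter> (\<Inter>k\<in>I. {u. app k u = (\<lambda>p. z k * u p)})"
    have "cfun.subspace W"
      unfolding W_def by (intro cfun.subspace_inter cfun.subspace_Int carrier_fun_subspace subspace_eigenspace)
    moreover have "app l v \<in> W" if "v \<in> W" for v
      using that by (auto simp: W_def mat_apply_carrier mat_apply_scale app_commute[of v _ l])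
    ultimately have "W \<subseteq> cfun.span {u \<in> W. \<exists>z. app l u = (\<lambda>a. z * u a)}"
      by (intro span_eigenvectors) (auto simp: W_def)
    also have "\<dots> \<subseteq> cfun.span (?J (insert l I))"
      by (rule cfun.span_mono) (auto simp: W_def)
    finally show "u \<in> cfun.span (?J (insert l I))"
      using u z by (auto simp: W_def)
  qed
  then have "cfun.span (?J I) \<subseteq> cfun.span (?J (insert l I))"
    by (intro cfun.span_minimal cfun.subspace_span)
  then show ?case
    using insert.IH by blast
qed

lemma eigenvectors_orthogonal:
  assumes "u \<in> carrier_fun P" "app k u = (\<lambda>p. z * u p)" "app k v = (\<lambda>p. z' * v p)" "z \<noteq> z'"
  shows "cinner P u v = 0"
proof -
  have "z' * cinner P u v = cinner P u (app k v)"
    by (simp add: assms(3) cinner_scale_right)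
  also have "\<dots> = cinner P (\<lambda>p. cnj z * u p) v"
    using eigenvector_adj_iff[OF assms(1)] assms(2) by (simp add: cinner_mat_apply_right)
  also have "\<dots> = z * cinner P u v"
    by (simp add: cinner_scale_left)
  finally show ?thesis
    using assms(4) by simp
qed

text \<open>The elements of \<open>Z\<close> are families of eigenvalues, one for each operator;
  they become the atoms. Eigenvectors with the same family are merged into one component, and two
  different families differ at some operator, which makes their components orthogonal.\<close>

lemma joint_eigendecomposition:
  assumes "finite (UNIV :: 'k set)" "u \<in> carrier_fun P"
  shows "\<exists>Z v. finite Z \<and> u = (\<lambda>p. \<Sum>z\<in>Z. v z p) \<and> (\<forall>z\<in>Z. v z \<in> carrier_fun P \<and> v z \<noteq> 0) \<and>
     (\<forall>z\<in>Z. \<forall>k. app k (v z) = (\<lambda>p. z k * v z p)) \<and>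
     (\<forall>z\<in>Z. \<forall>z'\<in>Z. z \<noteq> z' \<longrightarrow> cinner P (v z) (v z') = 0)"
proof -
  let ?J = "{u \<in> carrier_fun P. \<forall>k\<in>UNIV. \<exists>z. app k u = (\<lambda>p. z * u p)}"
  have "u \<in> cfun.span ?J"
    using span_joint_eigenvectors[OF assms(1)] assms(2) by blast
  then obtain S c where S: "finite S" "S \<subseteq> ?J" "u = (\<Sum>s\<in>S. (\<lambda>p. c s * s p))"
    unfolding cfun.span_explicit by blast
  have "\<exists>w. \<forall>k. app k s = (\<lambda>p. w k * s p)" if "s \<in> S" for s
    using S(2) that by (intro choice) auto
  then obtain w where w: "\<And>s k. s \<in> S \<Longrightarrow> app k s = (\<lambda>p. w s k * s p)"
    by metis
  define v where "v = (\<lambda>z p. \<Sum>s\<in>{s \<in> S. w s = z}. c s * s p)"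
  \<comment> \<open>Zero components are dropped: the squared norm of a component becomes a weight
    and has to be positive.\<close>
  define Z where "Z = {z \<in> w ` S. v z \<noteq> 0}"
  have carrier: "v z \<in> carrier_fun P" for z
    using S(2) unfolding v_def carrier_fun_def by (auto intro!: sum.neutral)
  have eig: "app k (v z) = (\<lambda>p. z k * v z p)" for k z
    unfolding v_def mat_apply_sum mat_apply_scale sum_distrib_left
    by (rule ext, rule sum.cong) (auto simp: w)
  have "u p = (\<Sum>z\<in>Z. v z p)" for p
  proof -
    have "u p = (\<Sum>s\<in>S. c s * s p)"
      unfolding S(3) sum_fun_apply ..
    also have "\<dots> = (\<Sum>z\<in>w ` S. v z p)"
      unfolding v_def using S(1) by (subst sum.image_gen[of S _ w]) auto
    also have "\<dots> = (\<Sum>z\<in>Z. v z p)"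
      unfolding Z_def using S(1) by (intro sum.mono_neutral_right) (auto simp: zero_fun_def)
    finally show ?thesis .
  qed
  moreover have "cinner P (v z) (v z') = 0" if ne: "z \<noteq> z'" for z z'
  proof -
    obtain k where "z k \<noteq> z' k"
      using ne by auto
    then show ?thesis
      using eigenvectors_orthogonal[OF carrier eig eig] by blast
  qed
  moreover have "finite Z"
    unfolding Z_def using S(1) by simp
  ultimately show ?thesis
    using carrier eig by (intro exI[of _ Z] exI[of _ v]) (auto simp: Z_def)
qed

end

subsection \<open>Moments of atomic measures\<close>

lemma mdeg_add: "mdeg (\<alpha> + \<beta>) = mdeg \<alpha> + mdeg \<beta>"
  unfolding mdeg_def by (simp add: sum.distrib)

lemma mdeg_axis [simp]: "mdeg (axis i k) = k"
  unfolding mdeg_def axis_def by (simp add: sum.delta)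

lemma mdeg_0 [simp]: "mdeg 0 = 0"
  unfolding mdeg_def by simp

lemma mindices_add: "\<alpha> \<in> mindices s \<Longrightarrow> mdeg \<gamma> \<le> l \<Longrightarrow> s + l \<le> t \<Longrightarrow> \<alpha> + \<gamma> \<in> mindices t"
  unfolding mindices_def by (simp add: mdeg_add)

lemma mindices_mono: "s \<le> t \<Longrightarrow> mindices s \<subseteq> mindices t"
  unfolding mindices_def by auto

lemma finite_mindices: "finite (mindices t :: 'n::finite mindex set)"
proof (rule finite_subset)
  show "(mindices t :: 'n mindex set) \<subseteq> vec_lambda ` (UNIV \<rightarrow>\<^sub>E {..t})"
  proof
    fix \<alpha> :: "'n mindex" assume "\<alpha> \<in> mindices t"
    then have "\<alpha> $ i \<le> t" for i
      using member_le_sum[of i UNIV "\<lambda>i. \<alpha> $ i"] unfolding mindices_def mdeg_def by simp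
    then have "(\<lambda>i. \<alpha> $ i) \<in> UNIV \<rightarrow>\<^sub>E {..t}"
      by auto
    then show "\<alpha> \<in> vec_lambda ` (UNIV \<rightarrow>\<^sub>E {..t})"
      by (metis imageI vec_nth_inverse)
  qed
qed (intro finite_imageI finite_PiE, auto)

lemma mpow_add: "mpow z (\<alpha> + \<beta>) = mpow z \<alpha> * mpow z \<beta>"
  unfolding mpow_def by (simp add: power_add prod.distrib)

lemma mpow_0 [simp]: "mpow z 0 = 1"
  unfolding mpow_def by simp

lemma mpow_axis [simp]: "mpow z (axis i (Suc 0)) = z $ i"
proof -
  have "mpow z (axis i (Suc 0)) = (\<Prod>j\<in>UNIV. if j = i then z $ j else 1)"
    unfolding mpow_def axis_def by (intro prod.cong refl) simp
  then show ?thesis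
    by (simp add: prod.delta)
qed

lemma mpow_conj_vec: "mpow (conj_vec z) \<alpha> = cnj (mpow z \<alpha>)"
  unfolding mpow_def conj_vec_def by simp

section \<open>Localizing matrices\<close>

lemma loc_mat_superset:
  assumes "finite S" "Poly_Mapping.keys \<phi> \<subseteq> S"
  shows "loc_mat \<phi> y \<alpha> \<beta> = (\<Sum>(\<gamma>, \<delta>)\<in>S. pcoeff \<phi> \<gamma> \<delta> * y (\<alpha> + \<gamma>) (\<beta> + \<delta>))"
  unfolding loc_mat_def using assms
  by (intro sum.mono_neutral_left) (auto simp: in_keys_iff)

lemma loc_mat_single:
  "loc_mat (Poly_Mapping.single (\<gamma>, \<delta>) c) y \<alpha> \<beta> = c * y (\<alpha> + \<gamma>) (\<beta> + \<delta>)"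
  by (subst loc_mat_superset[of "{(\<gamma>, \<delta>)}"]) auto

lemma loc_mat_add: "loc_mat (\<phi> + \<psi>) y \<alpha> \<beta> = loc_mat \<phi> y \<alpha> \<beta> + loc_mat \<psi> y \<alpha> \<beta>"
proof -
  let ?S = "Poly_Mapping.keys \<phi> \<union> Poly_Mapping.keys \<psi>"
  have "Poly_Mapping.keys (\<phi> + \<psi>) \<subseteq> ?S"
    by (rule Poly_Mapping.keys_add)
  then show ?thesis
    by (subst (1 2 3) loc_mat_superset[of ?S])
       (auto simp: lookup_add distrib_right sum.distrib split_beta)
qed

lemma loc_mat_diff: "loc_mat (\<phi> - \<psi>) y \<alpha> \<beta> = loc_mat \<phi> y \<alpha> \<beta> - loc_mat \<psi> y \<alpha> \<beta>"
  using loc_mat_add[of "\<phi> - \<psi>" \<psi> y \<alpha> \<beta>] by simp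

lemma loc_mat_sum: "loc_mat (\<Sum>i\<in>I. f i) y \<alpha> \<beta> = (\<Sum>i\<in>I. loc_mat (f i) y \<alpha> \<beta>)"
  by (induction I rule: infinite_finite_induct) (auto simp: loc_mat_add, simp_all add: loc_mat_def)

lemma loc_mat_one: "loc_mat 1 y = y"
proof -
  have "loc_mat (Poly_Mapping.single (0, 0) 1) y = y"
    by (intro ext) (simp add: loc_mat_single)
  then show ?thesis
    by (metis single_one zero_prod_def)
qed

lemma pcvar_mult_pvar: "pcvar i * pvar j = Poly_Mapping.single (axis i 1, axis j 1) 1"
  unfolding pcvar_def pvar_def by (simp add: mult_single)

lemma loc_mat_pconst: "loc_mat (pconst c) y \<alpha> \<beta> = c * y \<alpha> \<beta>"
  and loc_mat_pvar: "loc_mat (pvar i) y \<alpha> \<beta> = y \<alpha> (\<beta> + axis i 1)"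
  and loc_mat_pcvar: "loc_mat (pcvar i) y \<alpha> \<beta> = y (\<alpha> + axis i 1) \<beta>"
  and loc_mat_pcvar_pvar:
    "loc_mat (pcvar i * pvar j) y \<alpha> \<beta> = y (\<alpha> + axis i 1) (\<beta> + axis j 1)"
  unfolding pcvar_mult_pvar by (simp_all add: pconst_def pvar_def pcvar_def loc_mat_single)

text \<open>The finite-sum counterpart of a representing measure. All algebra is done with the
  points and weights; measures enter only through the two translation lemmas
  \<open>atomic_representing_measure_of_moments\<close> and
  \<open>atomic_representing_measure_moments\<close>.\<close>

definition atomic_moments ::
  "nat \<Rightarrow> ('n::finite mindex \<Rightarrow> 'n mindex \<Rightarrow> complex) \<Rightarrow> (complex ^ 'n) set \<Rightarrow> (complex ^ 'n \<Rightarrow> real) \<Rightarrow> bool"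
  where "atomic_moments d y Z w \<longleftrightarrow> finite Z \<and> (\<forall>z\<in>Z. 0 < w z) \<and>
    (\<forall>\<alpha>\<in>mindices d. \<forall>\<beta>\<in>mindices d. y \<alpha> \<beta> = (\<Sum>z\<in>Z. of_real (w z) * cnj (mpow z \<alpha>) * mpow z \<beta>))"

text \<open>Multiplying the family by \<open>\<phi>\<close> multiplies the weight of each atom by
  the value of \<open>\<phi>\<close> there. The bound \<open>s + l \<le> d\<close> keeps all raised
  indices in the range where the atoms represent \<open>y\<close>.\<close>

lemma loc_mat_atomic:
  assumes "atomic_moments d y Z w"
    and deg: "\<And>\<gamma> \<delta>. (\<gamma>, \<delta>) \<in> Poly_Mapping.keys \<phi> \<Longrightarrow> mdeg \<gamma> \<le> l \<and> mdeg \<delta> \<le> l"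
    and "s + l \<le> d" "\<alpha> \<in> mindices s" "\<beta> \<in> mindices s"
  shows "loc_mat \<phi> y \<alpha> \<beta> = (\<Sum>z\<in>Z. of_real (w z) * peval \<phi> z * cnj (mpow z \<alpha>) * mpow z \<beta>)"
proof -
  have "loc_mat \<phi> y \<alpha> \<beta> = (\<Sum>(\<gamma>, \<delta>)\<in>Poly_Mapping.keys \<phi>. pcoeff \<phi> \<gamma> \<delta> *
      (\<Sum>z\<in>Z. of_real (w z) * cnj (mpow z (\<alpha> + \<gamma>)) * mpow z (\<beta> + \<delta>)))"
    unfolding loc_mat_def
  proof (rule sum.cong[OF refl], clarify)
    fix \<gamma> \<delta> assume "(\<gamma>, \<delta>) \<in> Poly_Mapping.keys \<phi>"
    then have "\<alpha> + \<gamma> \<in> mindices d" "\<beta> + \<delta> \<in> mindices d"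
      using deg assms(3-5) mindices_add by blast+
    then show "pcoeff \<phi> \<gamma> \<delta> * y (\<alpha> + \<gamma>) (\<beta> + \<delta>) = pcoeff \<phi> \<gamma> \<delta> *
        (\<Sum>z\<in>Z. of_real (w z) * cnj (mpow z (\<alpha> + \<gamma>)) * mpow z (\<beta> + \<delta>))"
      using assms(1) unfolding atomic_moments_def by simp
  qed
  also have "\<dots> = (\<Sum>z\<in>Z. \<Sum>(\<gamma>, \<delta>)\<in>Poly_Mapping.keys \<phi>. pcoeff \<phi> \<gamma> \<delta> *
      (of_real (w z) * cnj (mpow z (\<alpha> + \<gamma>)) * mpow z (\<beta> + \<delta>)))"
    unfolding sum_distrib_left split_beta by (rule sum.swap)
  also have "\<dots> = (\<Sum>z\<in>Z. of_real (w z) * peval \<phi> z * cnj (mpow z \<alpha>) * mpow z \<beta>)"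
    unfolding peval_def sum_distrib_left sum_distrib_right split_beta
    by (intro sum.cong refl) (simp add: mpow_add mpow_conj_vec mult_ac)
  finally show ?thesis .
qed

section \<open>Rank, positivity and separation for finite atomic sums\<close>

lemma spanning_scale:
  assumes "spanning A P x" "\<And>p. p \<in> P \<Longrightarrow> h p \<noteq> 0"
  shows "spanning A P (\<lambda>a p. h p * x a p)"
  unfolding spanning_def
proof
  fix p assume p: "p \<in> P"
  then obtain c where c: "\<And>q. q \<in> P \<Longrightarrow> (\<Sum>a\<in>A. c a * x a q) = (if q = p then 1 else 0)"
    using assms(1) unfolding spanning_def by blast
  have "(\<Sum>a\<in>A. c a / h p * (h q * x a q)) = (if q = p then 1 else 0)" if "q \<in> P" for q
  proof -
    have "(\<Sum>a\<in>A. c a / h p * (h q * x a q)) = h q / h p * (\<Sum>a\<in>A. c a * x a q)"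
      unfolding sum_distrib_left by (intro sum.cong refl) simp
    then show ?thesis
      using c[OF that] assms(2)[OF p] by simp
  qed
  then show "\<exists>c. \<forall>q\<in>P. (\<Sum>a\<in>A. c a * (h q * x a q)) = (if q = p then 1 else 0)"
    by (intro exI[of _ "\<lambda>a. c a / h p"]) simp
qed

lemma spanning_unscale:
  assumes "spanning A P (\<lambda>a p. h p * x a p)" "\<And>p. p \<in> P \<Longrightarrow> h p \<noteq> 0"
  shows "spanning A P x"
proof -
  have "spanning A P (\<lambda>a p. inverse (h p) * (h p * x a p))"
    by (rule spanning_scale[OF assms(1)]) (use assms(2) in auto)
  then have sp: "\<exists>c. \<forall>q\<in>P. (\<Sum>a\<in>A. c a * (inverse (h q) * (h q * x a q))) = (if q = p then 1 else 0)"
    if "p \<in> P" for p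
    using that unfolding spanning_def by blast
  have "inverse (h q) * (h q * x a q) = x a q" if "q \<in> P" for a q
    using assms(2)[OF that] by simp
  then have "(\<Sum>a\<in>A. c a * (inverse (h q) * (h q * x a q))) = (\<Sum>a\<in>A. c a * x a q)" if "q \<in> P" for c q
    using that by presburger
  then show ?thesis
    using sp unfolding spanning_def by (simp cong: ball_cong)
qed

lemma spanning_coord_subset: "spanning A P x \<Longrightarrow> Q \<subseteq> P \<Longrightarrow> spanning A Q x"
  unfolding spanning_def by blast

text \<open>The vectors with entries \<open>sqrt (h z) * mpow z a\<close>, over the atoms with
  \<open>h z \<noteq> 0\<close>, are a spanning Gram system. With \<open>h\<close> the weights, the
  rank counts all atoms; with \<open>h\<close> the weights times the values of a constraint, it
  counts the atoms that are not zeros of the constraint.\<close>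

lemma rank_atomic:
  assumes "finite Z" "finite A" "spanning A Z (\<lambda>a z. mpow z a)"
    and h: "\<And>z. z \<in> Z \<Longrightarrow> 0 \<le> (h z :: real)"
    and M: "\<And>a b. a \<in> A \<Longrightarrow> b \<in> A \<Longrightarrow> M a b = (\<Sum>z\<in>Z. of_real (h z) * cnj (mpow z a) * mpow z b)"
  shows "rank_mat A M = card {z \<in> Z. h z \<noteq> 0}"
proof (rule rank_gram_spanning)
  let ?Z = "{z \<in> Z. h z \<noteq> 0}"
  let ?x = "\<lambda>a z. complex_of_real (sqrt (h z)) * mpow z a"
  show "spanning A ?Z ?x"
    by (rule spanning_scale[OF spanning_coord_subset[OF assms(3)]]) auto
  fix a b assume "a \<in> A" "b \<in> A"
  then have "M a b = (\<Sum>z\<in>Z. of_real (h z) * cnj (mpow z a) * mpow z b)"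
    by (rule M)
  also have "\<dots> = (\<Sum>z\<in>?Z. of_real (h z) * cnj (mpow z a) * mpow z b)"
    using assms(1) by (intro sum.mono_neutral_right) auto
  also have "\<dots> = cinner ?Z (?x a) (?x b)"
    unfolding cinner_def
  proof (rule sum.cong[OF refl])
    fix z assume "z \<in> ?Z"
    then have "complex_of_real (h z) = of_real (sqrt (h z)) * of_real (sqrt (h z))"
      using h by (simp flip: of_real_mult)
    then show "of_real (h z) * cnj (mpow z a) * mpow z b = cnj (?x a z) * ?x b z"
      by (simp add: mult_ac)
  qed
  finally show "M a b = cinner ?Z (?x a) (?x b)" .
qed (use assms in auto)

text \<open>The functions \<open>m\<close> are general because the block matrix of condition 3
  involves monomials times conjugated coordinates.\<close>

lemma psd_atomic:
  assumes h: "\<And>z. z \<in> Z \<Longrightarrow> 0 \<le> (h z :: real)"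
    and M: "\<And>a b. a \<in> A \<Longrightarrow> b \<in> A \<Longrightarrow> M a b = (\<Sum>z\<in>Z. of_real (h z) * cnj (m a z) * m b z)"
  shows "psd_mat A M"
proof (rule psd_gram)
  let ?x = "\<lambda>a z. complex_of_real (sqrt (h z)) * m a z"
  fix a b assume ab: "a \<in> A" "b \<in> A"
  show "M a b = cinner Z (?x a) (?x b)"
    unfolding cinner_def M[OF ab]
  proof (rule sum.cong[OF refl])
    fix z assume "z \<in> Z"
    then have "complex_of_real (h z) = of_real (sqrt (h z)) * of_real (sqrt (h z))"
      using h by (simp flip: of_real_mult)
    then show "of_real (h z) * cnj (m a z) * m b z = cnj (?x a z) * ?x b z"
      by (simp add: mult_ac)
  qed
qed

text \<open>For necessity: when the number of atoms equals the rank, \<open>spanning_if_rank\<close>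
  applies to the Gram vectors, and the nonzero factors \<open>sqrt (w z)\<close> can be
  removed.\<close>

lemma spanning_atomic:
  assumes "finite Z" "finite A" "\<And>z. z \<in> Z \<Longrightarrow> 0 < (w z :: real)" "rank_mat A M = card Z"
    and M: "\<And>a b. a \<in> A \<Longrightarrow> b \<in> A \<Longrightarrow> M a b = (\<Sum>z\<in>Z. of_real (w z) * cnj (mpow z a) * mpow z b)"
  shows "spanning A Z (\<lambda>a z. mpow z a)"
proof -
  let ?x = "\<lambda>a z. complex_of_real (sqrt (w z)) * mpow z a"
  have "spanning A Z ?x"
  proof (rule spanning_if_rank)
    fix a b assume ab: "a \<in> A" "b \<in> A"
    show "M a b = cinner Z (?x a) (?x b)"
      unfolding cinner_def M[OF ab]
    proof (rule sum.cong[OF refl])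
      fix z assume "z \<in> Z"
      then have "complex_of_real (w z) = of_real (sqrt (w z)) * of_real (sqrt (w z))"
        using assms(3) by (simp add: less_imp_le flip: of_real_mult)
      then show "of_real (w z) * cnj (mpow z a) * mpow z b = cnj (?x a z) * ?x b z"
        by (simp add: mult_ac)
    qed
  qed (use assms in auto)
  then show ?thesis
    by (rule spanning_unscale) (use assms(3) in fastforce)
qed

section \<open>Translation between finite sums and measures\<close>

lemma emeasure_distr_point_measure:
  fixes Z :: "('a::t2_space) set"
  assumes "finite Z" "B \<in> sets borel"
  shows "emeasure (distr (point_measure Z (\<lambda>z. ennreal (w z))) borel (\<lambda>z. z)) B =
    (\<Sum>z\<in>Z. ennreal (w z) * emeasure (return borel z) B)"
proof -
  have "emeasure (distr (point_measure Z (\<lambda>z. ennreal (w z))) borel (\<lambda>z. z)) B =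
      emeasure (point_measure Z (\<lambda>z. ennreal (w z))) (B \<inter> Z)"
    using assms(2) by (subst emeasure_distr) (auto simp: space_point_measure)
  also have "\<dots> = (\<Sum>z\<in>B \<inter> Z. ennreal (w z))"
    using assms(1) by (subst emeasure_point_measure_finite) auto
  also have "\<dots> = (\<Sum>z\<in>Z. if z \<in> B then ennreal (w z) else 0)"
    using assms(1) by (subst Int_commute) (rule sum.inter_restrict)
  also have "\<dots> = (\<Sum>z\<in>Z. ennreal (w z) * emeasure (return borel z) B)"
    using assms(2) by (intro sum.cong refl) (simp add: indicator_def)
  finally show ?thesis .
qed

lemma moment_function_measurable:
  "(\<lambda>z. mpow (conj_vec z) \<alpha> * mpow z \<beta>) \<in> borel_measurable borel"
  unfolding mpow_conj_vec unfolding mpow_def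
  by (intro borel_measurable_continuous_onI continuous_intros)

lemma integral_distr_point_measure:
  fixes f :: "'a::t2_space \<Rightarrow> complex"
  assumes "finite Z" "\<And>z. z \<in> Z \<Longrightarrow> 0 < w z" "f \<in> borel_measurable borel"
  shows "(LINT z|distr (point_measure Z (\<lambda>z. ennreal (w z))) borel (\<lambda>z. z). f z) =
    (\<Sum>z\<in>Z. of_real (w z) * f z)"
proof -
  have "(LINT z|distr (point_measure Z (\<lambda>z. ennreal (w z))) borel (\<lambda>z. z). f z) =
      (LINT z|point_measure Z (\<lambda>z. ennreal (w z)). f z)"
    using assms(3) by (subst integral_distr) auto
  also have "\<dots> = (\<Sum>z\<in>Z. w z *\<^sub>R f z)"
    using assms by (intro lebesgue_integral_point_measure_finite) (auto simp: less_imp_le)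
  finally show ?thesis
    by (simp add: scaleR_conv_of_real)
qed

lemma atomic_representing_measure_of_moments:
  assumes "atomic_moments d y Z w" "Z \<subseteq> K"
  shows "\<exists>\<mu>. atomic_representing_measure (card Z) K d y \<mu>"
proof
  \<comment> \<open>The point measure lives on the power set of \<open>Z\<close>; its image under
    the identity is a Borel measure on the whole space.\<close>
  let ?\<mu> = "distr (point_measure Z (\<lambda>z. ennreal (w z))) borel (\<lambda>z. z)"
  have fin: "finite Z" and w: "\<And>z. z \<in> Z \<Longrightarrow> 0 < w z"
    using assms(1) unfolding atomic_moments_def by auto
  have "atomic_measure (card Z) ?\<mu>"
    unfolding atomic_measure_def using fin w emeasure_distr_point_measure[OF fin]
    by (intro conjI exI[of _ Z] exI[of _ w]) auto
  moreover have "AE z in ?\<mu>. z \<in> K"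
  proof (rule AE_I')
    have "- Z \<in> sets borel"
      using fin by (intro borel_comp) (simp add: finite_imp_closed)
    then show "- Z \<in> null_sets ?\<mu>"
      using emeasure_distr_point_measure[OF fin, of "- Z" w] by (auto simp: null_sets_def fin indicator_def)
    show "{z \<in> space ?\<mu>. z \<notin> K} \<subseteq> - Z"
      using assms(2) by auto
  qed
  moreover have "y \<alpha> \<beta> = (LINT z|?\<mu>. mpow (conj_vec z) \<alpha> * mpow z \<beta>)"
    if "\<alpha> \<in> mindices d" "\<beta> \<in> mindices d" for \<alpha> \<beta>
    using assms(1) that unfolding atomic_moments_def
    by (subst integral_distr_point_measure[OF fin w moment_function_measurable])
       (auto simp: mpow_conj_vec mult.assoc)
  ultimately show "atomic_representing_measure (card Z) K d y ?\<mu>"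
    unfolding atomic_representing_measure_def by blast
qed

lemma atomic_representing_measure_moments:
  assumes "atomic_representing_measure r K d y \<mu>"
  shows "\<exists>Z w. atomic_moments d y Z w \<and> card Z = r \<and> Z \<subseteq> K \<and> atoms \<mu> = Z"
proof -
  from assms obtain Z w where sets: "sets \<mu> = sets borel" and fin: "finite Z" and card: "card Z = r"
    and w: "\<And>z. z \<in> Z \<Longrightarrow> 0 < (w z :: real)"
    and em: "\<And>B. B \<in> sets borel \<Longrightarrow>
      emeasure \<mu> B = (\<Sum>z\<in>Z. ennreal (w z) * emeasure (return borel z) B)"
    unfolding atomic_representing_measure_def atomic_measure_def by blast
  \<comment> \<open>The prescribed values on Borel sets determine the measure, so it may be replaced
    by the concrete one whose integrals are finite sums.\<close>
  have \<mu>: "\<mu> = distr (point_measure Z (\<lambda>z. ennreal (w z))) borel (\<lambda>z. z)"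
    using sets em emeasure_distr_point_measure[OF fin] by (intro measure_eqI) auto
  have pos: "0 < emeasure \<mu> B" if "B \<in> sets borel" "z \<in> Z" "z \<in> B" for B z
  proof -
    have "0 < ennreal (w z) * emeasure (return borel z) B"
      using w[OF that(2)] that by (simp add: indicator_def)
    also have "\<dots> \<le> emeasure \<mu> B"
      unfolding em[OF that(1)] using fin that(2) by (intro member_le_sum) auto
    finally show ?thesis .
  qed
  have "atoms \<mu> = Z"
  proof
    show "Z \<subseteq> atoms \<mu>"
      unfolding atoms_def using pos[of "{z}" z for z] by auto
    show "atoms \<mu> \<subseteq> Z"
    proof
      fix z assume "z \<in> atoms \<mu>"
      then have "(\<Sum>s\<in>Z. ennreal (w s) * emeasure (return borel s) {z}) \<noteq> 0"
        unfolding atoms_def by (simp add: em)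
      then obtain s where "s \<in> Z" "ennreal (w s) * emeasure (return borel s) {z} \<noteq> 0"
        by (meson sum.neutral)
      then show "z \<in> Z"
        by (auto simp: indicator_def split: if_splits)
    qed
  qed
  moreover have "Z \<subseteq> K"
  proof
    fix z assume z: "z \<in> Z"
    have "AE z in \<mu>. z \<in> K"
      using assms unfolding atomic_representing_measure_def by blast
    then obtain N where N: "{z \<in> space \<mu>. z \<notin> K} \<subseteq> N" "emeasure \<mu> N = 0" "N \<in> sets \<mu>"
      by (rule AE_E)
    \<comment> \<open>A measurable set that contains an atom has positive measure, whereas
      \<open>N\<close> is null.\<close>
    have "z \<notin> N"
      using pos[of N z] N z sets by auto
    then show "z \<in> K"
      using N(1) sets_eq_imp_space_eq[OF sets] by auto
  qed
  moreover have "atomic_moments d y Z w"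
    unfolding atomic_moments_def
  proof (intro conjI ballI)
    fix \<alpha> \<beta> :: "'a mindex" assume "\<alpha> \<in> mindices d" "\<beta> \<in> mindices d"
    then have "y \<alpha> \<beta> = (LINT z|\<mu>. mpow (conj_vec z) \<alpha> * mpow z \<beta>)"
      using assms unfolding atomic_representing_measure_def by blast
    also have "\<dots> = (\<Sum>z\<in>Z. of_real (w z) * (mpow (conj_vec z) \<alpha> * mpow z \<beta>))"
      unfolding \<mu> by (rule integral_distr_point_measure[OF fin w moment_function_measurable])
    finally show "y \<alpha> \<beta> = (\<Sum>z\<in>Z. of_real (w z) * cnj (mpow z \<alpha>) * mpow z \<beta>)"
      by (simp add: mpow_conj_vec mult.assoc)
  qed (use fin w in auto)
  ultimately show ?thesis
    using card by blast
qed

subsection \<open>Flat extensions\<close>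

definition sesq :: "'a set \<Rightarrow> ('a \<Rightarrow> 'a \<Rightarrow> complex) \<Rightarrow> ('a \<Rightarrow> complex) \<Rightarrow> ('a \<Rightarrow> complex) \<Rightarrow> complex" where
  "sesq A M u v = (\<Sum>a\<in>A. \<Sum>b\<in>A. cnj (u a) * M a b * v b)"

lemma sesq_gram:
  assumes "\<And>a b. a \<in> A \<Longrightarrow> b \<in> A \<Longrightarrow> M a b = cinner P (x a) (y b)"
  shows "sesq A M u v = cinner P (\<lambda>p. \<Sum>a\<in>A. u a * x a p) (\<lambda>p. \<Sum>b\<in>A. v b * y b p)"
  unfolding sesq_def cinner_combination using assms by (intro sum.cong refl) simp

text \<open>\<open>bound\<close> is the form in which the radius constraints enter, and
  \<open>pos\<close> is the quadratic form of the block matrix at the blocks \<open>u0\<close>,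
  \<open>u i\<close>, \<open>u j\<close>. The spanning property in the conclusion provides the
  interpolation polynomials by which single atoms are tested later.\<close>

lemma flat_extension_atoms:
  fixes y :: "'n::finite mindex \<Rightarrow> 'n mindex \<Rightarrow> complex"
  defines "e \<equiv> \<lambda>k :: 'n. axis k 1 :: 'n mindex"
  assumes "s < d"
    and psd: "psd_mat (mindices d) y"
    and rank: "rank_mat (mindices d) y = rank_mat (mindices s) y"
    and bound: "\<And>k. \<exists>C. \<forall>v. Re (sesq (mindices (d - 1)) (\<lambda>\<alpha> \<beta>. y (\<alpha> + e k) (\<beta> + e k)) v v)
        \<le> C * Re (sesq (mindices (d - 1)) y v v)"
    and card: "CARD('n) > 1"
    and pos: "\<And>i j u0 u. i \<noteq> j \<Longrightarrow> 0 \<le> Re (sesq (mindices s) y u0 u0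
        + (\<Sum>k\<in>{i, j}. sesq (mindices s) (\<lambda>\<alpha> \<beta>. y (\<alpha> + e k) \<beta>) u0 (u k)
                     + sesq (mindices s) (\<lambda>\<alpha> \<beta>. y \<alpha> (\<beta> + e k)) (u k) u0)
        + (\<Sum>k\<in>{i, j}. \<Sum>l\<in>{i, j}. sesq (mindices s) (\<lambda>\<alpha> \<beta>. y (\<alpha> + e l) (\<beta> + e k)) (u k) (u l)))"
  shows "\<exists>Z w. atomic_moments d y Z w \<and> spanning (mindices s) Z (\<lambda>\<alpha> z. mpow z \<alpha>)"
proof -
  let ?D = "mindices d :: 'n mindex set" and ?D' = "mindices (d - 1) :: 'n mindex set"
    and ?A = "mindices s :: 'n mindex set"
  have sub: "?A \<subseteq> ?D'" "?A \<subseteq> ?D" "?D' \<subseteq> ?D"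
    using \<open>s < d\<close> by (auto intro: mindices_mono[THEN subsetD, rotated])
  have shift: "\<alpha> + e k \<in> ?D" if "\<alpha> \<in> ?D'" for \<alpha> k
    using mindices_add[OF that, of "e k" 1 d] \<open>s < d\<close> unfolding e_def by simp
  obtain r :: nat and x0 where x0: "\<And>\<alpha> \<beta>. \<alpha> \<in> ?D \<Longrightarrow> \<beta> \<in> ?D \<Longrightarrow> y \<alpha> \<beta> = cinner {..<r} (x0 \<alpha>) (x0 \<beta>)"
    and sp0: "spanning ?D {..<r} x0"
    using psd_gram_factorization[OF finite_mindices psd] by blast
  define P where "P = {..<r}"
  have finP: "finite P"
    unfolding P_def by simp
  define x where "x = (\<lambda>\<alpha> p. if p \<in> P then x0 \<alpha> p else 0)"
  have x: "y \<alpha> \<beta> = cinner P (x \<alpha>) (x \<beta>)" if "\<alpha> \<in> ?D" "\<beta> \<in> ?D" for \<alpha> \<beta>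
    unfolding x0[OF that] P_def[symmetric] by (rule cinner_cong) (auto simp: x_def)
  have sp: "spanning ?D P x"
    using sp0 unfolding spanning_def P_def[symmetric] x_def by simp
  have xP: "x \<alpha> \<in> carrier_fun P" for \<alpha>
    unfolding x_def carrier_fun_def by simp
  have "rank_mat ?D y = card P"
    by (rule rank_gram_spanning[OF finite_mindices finP x sp])
  then have spA: "spanning ?A P x"
    using spanning_if_rank[OF finite_mindices finP, of s y x] rank x sub(2) by auto
  have "\<exists>c. \<forall>p\<in>P. (\<Sum>\<alpha>\<in>?A. c \<alpha> * x \<alpha> p) = u p" for u
    using spanning_coordinates[OF spA finP] by blast
  then obtain coord where coord: "\<And>u p. p \<in> P \<Longrightarrow> (\<Sum>\<alpha>\<in>?A. coord u \<alpha> * x \<alpha> p) = u p"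
    by metis
  \<comment> \<open>Degree at most \<open>d - 1\<close> keeps the shifted indices within degree
    \<open>d\<close>, so both sides of \<open>bound\<close> are squared norms of combinations of
    Gram vectors.\<close>
  have kernel: "(\<Sum>\<alpha>\<in>?D'. v \<alpha> * x (\<alpha> + e k) p) = 0"
    if v: "\<And>p. p \<in> P \<Longrightarrow> (\<Sum>\<alpha>\<in>?D'. v \<alpha> * x \<alpha> p) = 0" and p: "p \<in> P" for v k p
  proof -
    let ?f = "\<lambda>p. \<Sum>\<alpha>\<in>?D'. v \<alpha> * x (\<alpha> + e k) p"
    obtain C where C: "Re (sesq ?D' (\<lambda>\<alpha> \<beta>. y (\<alpha> + e k) (\<beta> + e k)) v v) \<le> C * Re (sesq ?D' y v v)"
      using bound[of k] by blast
    have "sesq ?D' (\<lambda>\<alpha> \<beta>. y (\<alpha> + e k) (\<beta> + e k)) v v = cinner P ?f ?f"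
      by (rule sesq_gram) (simp add: x shift)
    moreover have "sesq ?D' y v v = cinner P (\<lambda>p. \<Sum>\<alpha>\<in>?D'. v \<alpha> * x \<alpha> p) (\<lambda>p. \<Sum>\<alpha>\<in>?D'. v \<alpha> * x \<alpha> p)"
      by (rule sesq_gram) (rule x[OF subsetD[OF sub(3)] subsetD[OF sub(3)]])
    moreover have "cinner P (\<lambda>p. \<Sum>\<alpha>\<in>?D'. v \<alpha> * x \<alpha> p) (\<lambda>p. \<Sum>\<alpha>\<in>?D'. v \<alpha> * x \<alpha> p) = 0"
      unfolding cinner_self_eq_0[OF finP] using v by blast
    ultimately have "Re (cinner P ?f ?f) = 0"
      using C cinner_self_nonneg[of P ?f] by simp
    then have "cinner P ?f ?f = 0"
      by (simp add: cinner_self)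
    then have "\<forall>p\<in>P. ?f p = 0"
      by (rule iffD1[OF cinner_self_eq_0[OF finP]])
    then show ?thesis
      using p by simp
  qed
  \<comment> \<open>Column \<open>q\<close> arises by expanding the unit vector at \<open>q\<close>
    in the \<open>x \<alpha>\<close> of degree at most \<open>s\<close> and shifting every index.
    The expansion is an arbitrary choice; \<open>shift_x\<close> shows that the result nevertheless
    shifts each \<open>x \<beta>\<close> of degree at most \<open>d - 1\<close>.\<close>
  define T where "T = (\<lambda>k p q. \<Sum>\<alpha>\<in>?A. coord (\<lambda>q'. if q' = q then 1 else 0) \<alpha> * x (\<alpha> + e k) p)"
  have shift_x: "mat_apply P (T k) (x \<beta>) = x (\<beta> + e k)" if \<beta>: "\<beta> \<in> ?D'" for k \<beta>
  proof -
    define c where "c = (\<lambda>\<alpha>. \<Sum>q\<in>P. x \<beta> q * coord (\<lambda>q'. if q' = q then 1 else 0) \<alpha>)"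
    \<comment> \<open>The coefficients of the relation between \<open>x \<beta>\<close> and its
      expansion over \<open>?A\<close>; \<open>kernel\<close> carries this relation over to the
      shifted vectors.\<close>
    define v where "v = (\<lambda>\<alpha>. (if \<alpha> = \<beta> then 1 else 0) - (if \<alpha> \<in> ?A then c \<alpha> else 0))"
    have v: "(\<Sum>\<alpha>\<in>?D'. v \<alpha> * f \<alpha>) = f \<beta> - (\<Sum>\<alpha>\<in>?A. c \<alpha> * f \<alpha>)" for f :: "'n mindex \<Rightarrow> complex"
    proof -
      have "(\<Sum>\<alpha>\<in>?D'. v \<alpha> * f \<alpha>) = (\<Sum>\<alpha>\<in>?D'. if \<alpha> = \<beta> then f \<alpha> else 0) -
          (\<Sum>\<alpha>\<in>?D'. if \<alpha> \<in> ?A then c \<alpha> * f \<alpha> else 0)"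
        unfolding v_def sum_subtractf[symmetric]
        by (intro sum.cong refl) (auto simp: left_diff_distrib)
      also have "(\<Sum>\<alpha>\<in>?D'. if \<alpha> \<in> ?A then c \<alpha> * f \<alpha> else 0) = (\<Sum>\<alpha>\<in>?A. c \<alpha> * f \<alpha>)"
        using sub(1) by (intro sum.mono_neutral_cong_right finite_mindices) auto
      finally show ?thesis
        using \<beta> by (simp add: sum.delta finite_mindices)
    qed
    have expand: "(\<Sum>\<alpha>\<in>?A. c \<alpha> * f \<alpha>) =
        (\<Sum>q\<in>P. (\<Sum>\<alpha>\<in>?A. coord (\<lambda>q'. if q' = q then 1 else 0) \<alpha> * f \<alpha>) * x \<beta> q)" for f
      unfolding c_def sum_distrib_right
      by (subst sum.swap) (intro sum.cong refl, simp add: mult_ac)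
    have "(\<Sum>\<alpha>\<in>?D'. v \<alpha> * x \<alpha> p) = 0" if "p \<in> P" for p
    proof -
      have "(\<Sum>\<alpha>\<in>?A. c \<alpha> * x \<alpha> p) = (\<Sum>q\<in>P. (if p = q then 1 else 0) * x \<beta> q)"
        unfolding expand using that by (intro sum.cong refl) (simp only: coord)
      then show ?thesis
        unfolding v using that finP by (simp add: if_distrib if_distribR sum.delta cong: if_cong)
    qed
    then have "x (\<beta> + e k) p = mat_apply P (T k) (x \<beta>) p" if "p \<in> P" for p
      using kernel[of v p k] that unfolding v expand mat_apply_def T_def by simp
    then show ?thesis
      using carrier_eq_iff[OF mat_apply_carrier xP] by metis
  qed
  have apply_T: "mat_apply P (T k) (\<lambda>p. \<Sum>\<alpha>\<in>?A. u \<alpha> * x \<alpha> p) = (\<lambda>p. \<Sum>\<alpha>\<in>?A. u \<alpha> * x (\<alpha> + e k) p)" for k u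
    unfolding mat_apply_sum mat_apply_scale using shift_x sub(1)
    by (intro ext sum.cong refl) (auto dest: subsetD)
  have adj_commute: "(\<Sum>t\<in>P. cnj (T l t p) * T k t q) = (\<Sum>t\<in>P. T k p t * cnj (T l q t))"
    if ij: "i \<noteq> j" "k \<in> {i, j}" "l \<in> {i, j}" and pq: "p \<in> P" "q \<in> P" for i j k l p q
  proof (rule jointly_hyponormal_imp_commute[OF finP _ _ ij(2,3) pq])
    fix X0 and X :: "'n \<Rightarrow> nat \<Rightarrow> complex"
    define u0 where "u0 = coord X0"
    define u where "u = (\<lambda>k. coord (X k))"
    let ?init = "\<lambda>p. \<Sum>\<alpha>\<in>?A. u0 \<alpha> * x \<alpha> p" and ?comb = "\<lambda>k p. \<Sum>\<alpha>\<in>?A. u k \<alpha> * x \<alpha> p"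
    have X0: "X0 p = ?init p" and X: "X k p = ?comb k p" if "p \<in> P" for k p
      unfolding u0_def u_def using coord[OF that] by simp_all
    have TX0: "mat_apply P (T k) X0 = (\<lambda>p. \<Sum>\<alpha>\<in>?A. u0 \<alpha> * x (\<alpha> + e k) p)"
      and TX: "mat_apply P (T k) (X l) = (\<lambda>p. \<Sum>\<alpha>\<in>?A. u l \<alpha> * x (\<alpha> + e k) p)" for k l
      unfolding apply_T[symmetric] mat_apply_def using X0 X by (auto intro!: sum.cong)
    have inD: "\<alpha> \<in> ?D" "\<alpha> + e k \<in> ?D" if "\<alpha> \<in> ?A" for \<alpha> k
      using that sub shift by auto
    have 1: "cinner P X0 X0 = sesq ?A y u0 u0"
      by (subst sesq_gram[of _ _ P x x]) (auto intro!: cinner_cong simp: x inD X0)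
    have 2: "cinner P (mat_apply P (T k) X0) (X k) = sesq ?A (\<lambda>\<alpha> \<beta>. y (\<alpha> + e k) \<beta>) u0 (u k)" for k
      unfolding TX0
      by (subst sesq_gram[of _ _ P "\<lambda>\<alpha>. x (\<alpha> + e k)" x]) (auto intro!: cinner_cong simp: x inD X)
    have 3: "cinner P (X k) (mat_apply P (T k) X0) = sesq ?A (\<lambda>\<alpha> \<beta>. y \<alpha> (\<beta> + e k)) (u k) u0" for k
      unfolding TX0
      by (subst sesq_gram[of _ _ P x "\<lambda>\<alpha>. x (\<alpha> + e k)"]) (auto intro!: cinner_cong simp: x inD X)
    have 4: "cinner P (mat_apply P (T l) (X k)) (mat_apply P (T k) (X l)) =
        sesq ?A (\<lambda>\<alpha> \<beta>. y (\<alpha> + e l) (\<beta> + e k)) (u k) (u l)" for k l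
      unfolding TX
      by (subst sesq_gram[of _ _ P "\<lambda>\<alpha>. x (\<alpha> + e l)" "\<lambda>\<alpha>. x (\<alpha> + e k)"]) (auto simp: x inD)
    show "0 \<le> Re (cinner P X0 X0
        + (\<Sum>k\<in>{i, j}. cinner P (mat_apply P (T k) X0) (X k) + cinner P (X k) (mat_apply P (T k) X0))
        + (\<Sum>k\<in>{i, j}. \<Sum>l\<in>{i, j}. cinner P (mat_apply P (T l) (X k)) (mat_apply P (T k) (X l))))"
      unfolding 1 2 3 4 by (rule pos[OF ij(1)])
  qed simp
  interpret normal_family P T
  proof
    fix k l :: 'n and p q assume pq: "p \<in> P" "q \<in> P"
    \<comment> \<open>Normality of \<open>T k\<close> is read off from a pair that contains
      \<open>k\<close>, so a second index is needed; \<open>n > 1\<close> supplies it.\<close>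
    have "\<exists>j. j \<noteq> k"
      using card by (metis (full_types) UNIV_I card_1_singleton_iff is_singletonI' is_singleton_def
        less_irrefl One_nat_def empty_iff)
    then obtain j where "j \<noteq> k"
      by blast
    show "(\<Sum>t\<in>P. cnj (T l t p) * T k t q) = (\<Sum>t\<in>P. T k p t * cnj (T l q t))"
    proof (cases "k = l")
      case True
      then show ?thesis
        using adj_commute[of k j k l p q] \<open>j \<noteq> k\<close> pq by simp
    next
      case False
      then show ?thesis
        using adj_commute[of k l k l p q] pq by simp
    qed
  qed (rule finP)
  from joint_eigendecomposition[OF finite xP[of 0]] obtain W v
    where W: "finite W" "x 0 = (\<lambda>p. \<Sum>z\<in>W. v z p)"
    and vs: "\<forall>z\<in>W. v z \<in> carrier_fun P \<and> v z \<noteq> 0"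
      "\<forall>z\<in>W. \<forall>k. mat_apply P (T k) (v z) = (\<lambda>p. z k * v z p)"
      "\<forall>z\<in>W. \<forall>z'\<in>W. z \<noteq> z' \<longrightarrow> cinner P (v z) (v z') = 0"
    by (elim exE conjE) (rule that)
  have v: "v z \<in> carrier_fun P" "v z \<noteq> 0" and eig: "mat_apply P (T k) (v z) = (\<lambda>p. z k * v z p)"
    if "z \<in> W" for z k
    using bspec[OF vs(1) that] bspec[OF vs(2) that] by auto
  have orth: "cinner P (v z) (v z') = 0" if "z \<in> W" "z' \<in> W" "z \<noteq> z'" for z z'
    using vs(3)[rule_format, OF that] .
  define m where "m = (\<lambda>(z :: 'n \<Rightarrow> complex) \<beta>. mpow (vec_lambda z) \<beta> :: complex)"
  \<comment> \<open>With \<open>\<beta> = \<gamma> + e k\<close>, applying \<open>T k\<close> to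
    \<open>x \<gamma>\<close> multiplies the component \<open>v z\<close> by \<open>z k\<close>.
    Only \<open>\<gamma>\<close> has to stay within degree \<open>d - 1\<close>, so the
    decomposition reaches degree \<open>d\<close>.\<close>
  have decomp: "x \<beta> = (\<lambda>p. \<Sum>z\<in>W. m z \<beta> * v z p)" if "\<beta> \<in> ?D" for \<beta>
    using that
  proof (induction "mdeg \<beta>" arbitrary: \<beta>)
    case 0
    then have "\<beta> = 0"
      unfolding mdeg_def by (simp add: vec_eq_iff)
    then show ?case
      using W(2) unfolding m_def by simp
  next
    case (Suc n)
    then obtain k where k: "\<beta> $ k \<noteq> 0"
      unfolding mdeg_def by (metis sum.neutral nat.distinct(1))
    define \<gamma> where "\<gamma> = (\<chi> i. if i = k then \<beta> $ i - 1 else \<beta> $ i)"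
    have \<beta>: "\<beta> = \<gamma> + e k"
      unfolding \<gamma>_def e_def axis_def using k by (auto simp: vec_eq_iff)
    have deg: "mdeg \<gamma> = n"
      using Suc.hyps(2) unfolding \<beta> e_def by (simp add: mdeg_add)
    then have \<gamma>: "\<gamma> \<in> ?D'" "\<gamma> \<in> ?D"
      using Suc.hyps(2) Suc.prems unfolding mindices_def by auto
    have "x \<beta> = mat_apply P (T k) (x \<gamma>)"
      unfolding \<beta> shift_x[OF \<gamma>(1)] ..
    also have "\<dots> = (\<lambda>p. \<Sum>z\<in>W. m z \<gamma> * mat_apply P (T k) (v z) p)"
      unfolding Suc.hyps(1)[OF deg[symmetric] \<gamma>(2)] mat_apply_sum mat_apply_scale ..
    also have "\<dots> = (\<lambda>p. \<Sum>z\<in>W. m z \<beta> * v z p)"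
      by (intro ext sum.cong refl) (simp add: eig \<beta> m_def mpow_add e_def)
    finally show ?case .
  qed
  define w where "w = (\<lambda>z. Re (cinner P (v z) (v z)))"
  have cw: "cinner P (v z) (v z) = of_real (w z)" for z
    unfolding w_def cinner_self by simp
  have w_pos: "0 < w z" if "z \<in> W" for z
  proof -
    have "cinner P (v z) (v z) \<noteq> 0"
      using v[OF that] unfolding cinner_self_eq_0[OF finP] carrier_fun_def by (auto simp: fun_eq_iff)
    then show ?thesis
      using cinner_self_nonneg[of P "v z"] unfolding cw by simp
  qed
  have inner: "cinner P (v z) (\<lambda>p. \<Sum>z'\<in>W. f z' * v z' p) = f z * of_real (w z)" if "z \<in> W" for f z
  proof -
    have "cinner P (v z) (\<lambda>p. \<Sum>z'\<in>W. f z' * v z' p) = (\<Sum>z'\<in>W. if z' = z then f z' * of_real (w z') else 0)"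
      unfolding cinner_sum_right cinner_scale_right using that orth
      by (intro sum.cong refl) (auto simp: cw)
    then show ?thesis
      using that W(1) by (simp add: sum.delta)
  qed
  have moments: "y \<alpha> \<beta> = (\<Sum>z\<in>W. of_real (w z) * cnj (m z \<alpha>) * m z \<beta>)" if "\<alpha> \<in> ?D" "\<beta> \<in> ?D" for \<alpha> \<beta>
  proof -
    have "y \<alpha> \<beta> = cinner P (\<lambda>p. \<Sum>z\<in>W. m z \<alpha> * v z p) (\<lambda>p. \<Sum>z\<in>W. m z \<beta> * v z p)"
      unfolding x[OF that] decomp[OF that(1)] decomp[OF that(2)] ..
    also have "\<dots> = (\<Sum>z\<in>W. cnj (m z \<alpha>) * (m z \<beta> * of_real (w z)))"
      unfolding cinner_sum_left cinner_scale_left by (intro sum.cong refl) (simp add: inner)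
    finally show ?thesis
      by (simp add: mult_ac)
  qed
  \<comment> \<open>Expand the component \<open>v z\<close> in the \<open>x \<alpha>\<close> of
    degree at most \<open>s\<close> and pair it with \<open>v z'\<close>: after division by the
    weight, the expansion coefficients are those of a polynomial interpolating the indicator of
    \<open>z\<close>.\<close>
  have span: "\<exists>c. \<forall>z'\<in>W. (\<Sum>\<alpha>\<in>?A. c \<alpha> * m z' \<alpha>) = (if z' = z then 1 else 0)" if z: "z \<in> W" for z
  proof (intro exI ballI)
    fix z' assume z': "z' \<in> W"
    have "cinner P (v z') (v z) = cinner P (v z') (\<lambda>p. \<Sum>\<alpha>\<in>?A. coord (v z) \<alpha> * x \<alpha> p)"
      by (rule cinner_cong) (simp_all add: coord)
    also have "\<dots> = (\<Sum>\<alpha>\<in>?A. coord (v z) \<alpha> * (m z' \<alpha> * of_real (w z')))"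
      unfolding cinner_sum_right cinner_scale_right using sub(2)
      by (intro sum.cong refl) (auto simp: decomp inner[OF z'])
    also have "\<dots> = (\<Sum>\<alpha>\<in>?A. coord (v z) \<alpha> * m z' \<alpha>) * of_real (w z')"
      by (simp add: sum_distrib_right mult.assoc)
    finally have "(\<Sum>\<alpha>\<in>?A. coord (v z) \<alpha> * m z' \<alpha>) * of_real (w z') = (if z' = z then of_real (w z') else 0)"
      using orth[OF z' z] by (auto simp: cw)
    then show "(\<Sum>\<alpha>\<in>?A. coord (v z) \<alpha> * m z' \<alpha>) = (if z' = z then 1 else 0)"
      using w_pos[OF z'] by (auto split: if_splits)
  qed
  have inj: "inj_on vec_lambda W"
    by (rule inj_onI) (simp add: vec_lambda_inject)
  show ?thesis
  proof (intro exI[of _ "vec_lambda ` W"] exI[of _ "\<lambda>z. w (vec_nth z)"] conjI)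
    show "atomic_moments d y (vec_lambda ` W) (\<lambda>z. w (vec_nth z))"
      unfolding atomic_moments_def using W(1) w_pos moments
      by (auto simp: sum.reindex[OF inj] m_def vec_lambda_inverse)
    show "spanning ?A (vec_lambda ` W) (\<lambda>\<alpha> z. mpow z \<alpha>)"
      unfolding spanning_def
    proof clarify
      fix z assume z: "z \<in> W"
      obtain c where c: "\<And>z'. z' \<in> W \<Longrightarrow> (\<Sum>\<alpha>\<in>?A. c \<alpha> * m z' \<alpha>) = (if z' = z then 1 else 0)"
        using span[OF z] by blast
      show "\<exists>c. \<forall>q\<in>vec_lambda ` W. (\<Sum>\<alpha>\<in>?A. c \<alpha> * mpow q \<alpha>) = (if q = vec_lambda z then 1 else 0)"
        using c by (intro exI[of _ c]) (auto simp: m_def vec_lambda_inject)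
    qed
  qed
qed

section \<open>Condition 3 as a quadratic form\<close>

lemma block_form:
  fixes u :: "nat \<Rightarrow> 'a \<Rightarrow> complex"
  shows "(\<Sum>a\<in>{..<n} \<times> A. \<Sum>b\<in>{..<n} \<times> A. cnj (case_prod u a) * block_mat Ms a b * case_prod u b) =
     (\<Sum>p<n. \<Sum>q<n. sesq A (Ms ! p ! q) (u p) (u q))"
proof -
  have "(\<Sum>a\<in>{..<n} \<times> A. \<Sum>b\<in>{..<n} \<times> A. cnj (case_prod u a) * block_mat Ms a b * case_prod u b) =
      (\<Sum>p<n. \<Sum>a\<in>A. \<Sum>q<n. \<Sum>b\<in>A. cnj (u p a) * (Ms ! p ! q) a b * u q b)"
    unfolding sum.cartesian_product' block_mat_def by simp
  also have "\<dots> = (\<Sum>p<n. \<Sum>q<n. \<Sum>a\<in>A. \<Sum>b\<in>A. cnj (u p a) * (Ms ! p ! q) a b * u q b)"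
    by (intro sum.cong refl sum.swap)
  finally show ?thesis
    unfolding sesq_def .
qed

text \<open>An abbreviation, so that lemmas about it apply to the literal block list of the theorem
  without unfolding.\<close>

abbreviation (input) hyponormality_block ::
  "'n::finite \<Rightarrow> 'n \<Rightarrow> ('n mindex \<Rightarrow> 'n mindex \<Rightarrow> complex) \<Rightarrow>
    ('n mindex \<Rightarrow> 'n mindex \<Rightarrow> complex) list list" where
  "hyponormality_block i j y \<equiv>
    [[loc_mat 1 y, loc_mat (pcvar i) y, loc_mat (pcvar j) y],
     [loc_mat (pvar i) y, loc_mat (pcvar i * pvar i) y, loc_mat (pcvar j * pvar i) y],
     [loc_mat (pvar j) y, loc_mat (pcvar i * pvar j) y, loc_mat (pcvar j * pvar j) y]]"

lemma sum_lessThan_3: "(\<Sum>p<(3::nat). f p) = f 0 + f 1 + f 2"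
  by (simp add: numeral_3_eq_3 numeral_2_eq_2)

lemma hyponormality_block_form:
  fixes y :: "'n::finite mindex \<Rightarrow> 'n mindex \<Rightarrow> complex"
  assumes psd: "psd_mat ({..<3} \<times> A) (block_mat (hyponormality_block i j y))" and "i \<noteq> j"
  shows "0 \<le> Re (sesq A y u0 u0
        + (\<Sum>k\<in>{i, j}. sesq A (\<lambda>\<alpha> \<beta>. y (\<alpha> + axis k 1) \<beta>) u0 (u k)
                     + sesq A (\<lambda>\<alpha> \<beta>. y \<alpha> (\<beta> + axis k 1)) (u k) u0)
        + (\<Sum>k\<in>{i, j}. \<Sum>l\<in>{i, j}. sesq A (\<lambda>\<alpha> \<beta>. y (\<alpha> + axis l 1) (\<beta> + axis k 1)) (u k) (u l)))"
proof -
  \<comment> \<open>The block positions 0, 1, 2 carry \<open>u0\<close>, \<open>u i\<close>,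
    \<open>u j\<close>; since \<open>i \<noteq> j\<close>, the sums over \<open>{i, j}\<close> have
    two separate terms.\<close>
  let ?u = "\<lambda>p::nat. if p = 0 then u0 else if p = 1 then u i else u j"
  have loc: "loc_mat (pvar k) y = (\<lambda>\<alpha> \<beta>. y \<alpha> (\<beta> + axis k 1))"
    "loc_mat (pcvar k) y = (\<lambda>\<alpha> \<beta>. y (\<alpha> + axis k 1) \<beta>)"
    "loc_mat (pcvar l * pvar k) y = (\<lambda>\<alpha> \<beta>. y (\<alpha> + axis l 1) (\<beta> + axis k 1))" for k l
    by (intro ext loc_mat_pvar loc_mat_pcvar loc_mat_pcvar_pvar)+
  have "0 \<le> Re (\<Sum>p<3. \<Sum>q<3. sesq A (hyponormality_block i j y ! p ! q) (?u p) (?u q))"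
    using psd_mat_form_nonneg[OF psd, of "case_prod ?u"] unfolding block_form .
  then show ?thesis
    using \<open>i \<noteq> j\<close> unfolding sum_lessThan_3 loc_mat_one loc by (simp add: add_ac)
qed

lemma psd_shift:
  fixes y :: "'n::finite mindex \<Rightarrow> 'n mindex \<Rightarrow> complex"
  assumes "psd_mat (mindices d) y" "\<And>\<alpha>. \<alpha> \<in> A \<Longrightarrow> \<alpha> + \<gamma> \<in> mindices d"
  shows "psd_mat A (\<lambda>\<alpha> \<beta>. y (\<alpha> + \<gamma>) (\<beta> + \<gamma>))"
proof -
  obtain r :: nat and x where
    "\<forall>\<alpha>\<in>mindices d. \<forall>\<beta>\<in>mindices d. y \<alpha> \<beta> = cinner {..<r} (x \<alpha>) (x \<beta>)"
    using psd_gram_factorization[OF finite_mindices assms(1)] by blast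
  then show ?thesis
    by (intro psd_gram[of A _ "{..<r}" "\<lambda>\<alpha>. x (\<alpha> + \<gamma>)"]) (simp add: assms(2))
qed

section \<open>Radius constraints\<close>

lemma ball_constraint_coeff:
  fixes L :: "'n::finite set"
  shows "pcoeff (pconst c - (\<Sum>l\<in>L. pcvar l * pvar l)) \<alpha> \<beta> =
    (if \<alpha> = 0 \<and> \<beta> = 0 then c else 0) - (if \<exists>l\<in>L. \<alpha> = axis l 1 \<and> \<beta> = axis l 1 then 1 else 0)"
proof -
  have "(\<Sum>l\<in>L. pcoeff (pcvar l * pvar l) \<alpha> \<beta>) =
      (\<Sum>l\<in>L. if \<alpha> = axis l 1 \<and> \<beta> = axis l 1 then 1 else 0)"
    unfolding pcvar_mult_pvar by (intro sum.cong refl) (auto simp: lookup_single when_def)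
  also have "\<dots> = (if \<exists>l\<in>L. \<alpha> = axis l 1 \<and> \<beta> = axis l 1 then 1 else 0)"
  proof (cases "\<exists>l\<in>L. \<alpha> = axis l 1 \<and> \<beta> = axis l 1")
    case True
    then obtain l where l: "l \<in> L" "\<alpha> = axis l 1" "\<beta> = axis l 1"
      by blast
    have "(\<Sum>l'\<in>L. if \<alpha> = axis l' 1 \<and> \<beta> = axis l' 1 then 1 else 0) =
        (\<Sum>l'\<in>L. if l' = l then 1 else (0::complex))"
      unfolding l(2,3) by (intro sum.cong refl) (auto simp: axis_eq_axis)
    then show ?thesis
      using l by (auto simp: sum.delta)
  qed (auto intro!: sum.neutral)
  finally show ?thesis
    by (simp add: lookup_minus lookup_sum pconst_def lookup_single when_def)
qed

text \<open>Degrees count the conjugated and the plain variables separately, so a squared modulus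
  has degree 1. Hence the localizing matrix has order \<open>d - 1\<close>, the order at which
  shifts are defined, and \<open>d_K\<close> is at least 1.\<close>

lemma ball_constraint_degree:
  fixes L :: "'n::finite set"
  assumes "has_degree (pconst c - (\<Sum>l\<in>L. pcvar l * pvar l)) k" "L \<noteq> {}"
  shows "k = 1"
proof (rule antisym)
  let ?g = "pconst c - (\<Sum>l\<in>L. pcvar l * pvar l)"
  obtain \<alpha> \<beta> where "mdeg \<alpha> = k" "pcoeff ?g \<alpha> \<beta> \<noteq> 0"
    using assms(1) unfolding has_degree_def by blast
  then show "k \<le> 1"
    unfolding ball_constraint_coeff by (auto split: if_splits)
  obtain l where "l \<in> L"
    using assms(2) by blast
  then have "pcoeff ?g (axis l 1) (axis l 1) \<noteq> 0"
    unfolding ball_constraint_coeff by (auto simp: axis_eq_0_iff)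
  then have "(axis l 1, axis l 1) \<in> Poly_Mapping.keys ?g"
    by (simp add: in_keys_iff)
  then show "1 \<le> k"
    using assms(1) unfolding has_degree_def real_polys_def by fastforce
qed

text \<open>The form of the localizing matrix is \<open>c\<close> times the form of \<open>y\<close>
  minus the sum over \<open>L\<close> of the shifted forms. These are all nonnegative by
  \<open>psd_shift\<close>, so each one is bounded by their sum.\<close>

lemma ball_constraint_bound:
  fixes L :: "'n::finite set"
  assumes "psd_mat (mindices d) y" "1 \<le> d" "l \<in> L"
    and psd: "psd_mat (mindices (d - 1)) (loc_mat (pconst (of_real c) - (\<Sum>l\<in>L. pcvar l * pvar l)) y)"
  shows "Re (sesq (mindices (d - 1)) (\<lambda>\<alpha> \<beta>. y (\<alpha> + axis l 1) (\<beta> + axis l 1)) v v)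
        \<le> c * Re (sesq (mindices (d - 1)) y v v)"
proof -
  let ?A = "mindices (d - 1) :: 'n mindex set"
  let ?s = "\<lambda>l. sesq ?A (\<lambda>\<alpha> \<beta>. y (\<alpha> + axis l 1) (\<beta> + axis l 1)) v v"
  have nonneg: "0 \<le> Re (?s l)" for l
  proof -
    have "psd_mat ?A (\<lambda>\<alpha> \<beta>. y (\<alpha> + axis l 1) (\<beta> + axis l 1))"
      by (rule psd_shift[OF assms(1)], rule mindices_add[where s = "d - 1" and l = 1]) (use assms(2) in auto)
    then show ?thesis
      unfolding sesq_def by (rule psd_mat_form_nonneg)
  qed
  have "sesq ?A (loc_mat (pconst (of_real c) - (\<Sum>l\<in>L. pcvar l * pvar l)) y) v v =
      of_real c * sesq ?A y v v - (\<Sum>l\<in>L. ?s l)"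
  proof -
    have "(\<Sum>l\<in>L. ?s l) = (\<Sum>\<alpha>\<in>?A. \<Sum>\<beta>\<in>?A. \<Sum>l\<in>L. cnj (v \<alpha>) * y (\<alpha> + axis l 1) (\<beta> + axis l 1) * v \<beta>)"
      unfolding sesq_def by (subst sum.swap) (intro sum.cong refl sum.swap)
    then show ?thesis
      unfolding loc_mat_diff loc_mat_sum loc_mat_pcvar_pvar loc_mat_pconst sesq_def
      by (simp add: algebra_simps sum_subtractf sum_distrib_left)
  qed
  then have "(\<Sum>l\<in>L. Re (?s l)) \<le> c * Re (sesq ?A y v v)"
    using psd_mat_form_nonneg[OF psd, of v] unfolding sesq_def[symmetric] by simp
  moreover have "Re (?s l) \<le> (\<Sum>l\<in>L. Re (?s l))"
    using assms(3) nonneg by (intro member_le_sum) auto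
  ultimately show ?thesis
    by linarith
qed

text \<open>At the coefficients that interpolate the indicator of \<open>z\<close> on
  \<open>Z\<close>, the form of the localizing matrix reduces to the single term
  \<open>w z * peval \<phi> z\<close>.\<close>

lemma atoms_nonneg:
  fixes y :: "'n::finite mindex \<Rightarrow> 'n mindex \<Rightarrow> complex"
  assumes mom: "atomic_moments d y Z w" and sp: "spanning (mindices s) Z (\<lambda>\<alpha> z. mpow z \<alpha>)"
    and \<phi>: "\<phi> \<in> real_polys l" "s + l \<le> d" "psd_mat (mindices s) (loc_mat \<phi> y)"
    and z: "z \<in> Z"
  shows "0 \<le> Re (peval \<phi> z)"
proof -
  let ?A = "mindices s :: 'n mindex set"
  have Z: "finite Z" "0 < w z"
    using mom z unfolding atomic_moments_def by auto
  obtain c where c: "\<And>z'. z' \<in> Z \<Longrightarrow> (\<Sum>\<alpha>\<in>?A. c \<alpha> * mpow z' \<alpha>) = (if z' = z then 1 else 0)"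
    using sp z unfolding spanning_def by blast
  have "sesq ?A (loc_mat \<phi> y) c c = cinner Z (\<lambda>z. \<Sum>\<alpha>\<in>?A. c \<alpha> * mpow z \<alpha>)
      (\<lambda>z. \<Sum>\<alpha>\<in>?A. c \<alpha> * (of_real (w z) * peval \<phi> z * mpow z \<alpha>))"
  proof (rule sesq_gram)
    fix \<alpha> \<beta> assume "\<alpha> \<in> ?A" "\<beta> \<in> ?A"
    then have "loc_mat \<phi> y \<alpha> \<beta> = (\<Sum>z\<in>Z. of_real (w z) * peval \<phi> z * cnj (mpow z \<alpha>) * mpow z \<beta>)"
      using \<phi>(1,2) by (intro loc_mat_atomic[OF mom, of \<phi> l s]) (auto simp: real_polys_def)
    then show "loc_mat \<phi> y \<alpha> \<beta> = cinner Z (\<lambda>z. mpow z \<alpha>) (\<lambda>z. of_real (w z) * peval \<phi> z * mpow z \<beta>)"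
      unfolding cinner_def by (simp add: mult_ac)
  qed
  also have "\<dots> = (\<Sum>z'\<in>Z. if z' = z then of_real (w z') * peval \<phi> z' else 0)"
    unfolding cinner_def
  proof (rule sum.cong[OF refl])
    fix z' assume z': "z' \<in> Z"
    have "(\<Sum>\<alpha>\<in>?A. c \<alpha> * (of_real (w z') * peval \<phi> z' * mpow z' \<alpha>)) =
        of_real (w z') * peval \<phi> z' * (\<Sum>\<alpha>\<in>?A. c \<alpha> * mpow z' \<alpha>)"
      unfolding sum_distrib_left by (intro sum.cong refl) simp
    then show "cnj (\<Sum>\<alpha>\<in>?A. c \<alpha> * mpow z' \<alpha>) *
        (\<Sum>\<alpha>\<in>?A. c \<alpha> * (of_real (w z') * peval \<phi> z' * mpow z' \<alpha>)) =
        (if z' = z then of_real (w z') * peval \<phi> z' else 0)"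
      using c[OF z'] by simp
  qed
  also have "\<dots> = of_real (w z) * peval \<phi> z"
    using z Z(1) by (simp add: sum.delta)
  finally have "0 \<le> w z * Re (peval \<phi> z)"
    using psd_mat_form_nonneg[OF \<phi>(3), of c] unfolding sesq_def[symmetric] by simp
  then show ?thesis
    using Z(2) by (simp add: zero_le_mult_iff)
qed

text \<open>The block matrix is a weighted sum over the atoms of rank-one matrices built from 1,
  \<open>z $ i\<close>, \<open>z $ j\<close> times monomials. The coordinates enter conjugated
  because a row block carries the plain variable and a column block the conjugated one, opposite to
  the convention for \<open>\<alpha>\<close> and \<open>\<beta>\<close>.\<close>

lemma hyponormality_block_psd:
  fixes y :: "'n::finite mindex \<Rightarrow> 'n mindex \<Rightarrow> complex"
  assumes mom: "atomic_moments d y Z w" and "s < d"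
  shows "psd_mat ({..<3} \<times> mindices s) (block_mat (hyponormality_block i j y))"
proof (rule psd_atomic)
  let ?u = "\<lambda>p z. if p = 0 then 1 else if p = (1::nat) then z $ i else z $ j"
  fix a b :: "nat \<times> 'n mindex"
  assume "a \<in> {..<3} \<times> mindices s" "b \<in> {..<3} \<times> mindices s"
  then obtain p \<alpha> q \<beta> where ab: "a = (p, \<alpha>)" "b = (q, \<beta>)" "p < 3" "q < 3"
    "\<alpha> \<in> mindices s" "\<beta> \<in> mindices s"
    by auto
  have y: "y \<alpha>' \<beta>' = (\<Sum>z\<in>Z. of_real (w z) * cnj (mpow z \<alpha>') * mpow z \<beta>')"
    if "\<alpha>' \<in> mindices d" "\<beta>' \<in> mindices d" for \<alpha>' \<beta>'
    using mom that unfolding atomic_moments_def by blast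
  have mem: "\<alpha>' \<in> mindices d" "\<alpha>' + axis k (Suc 0) \<in> mindices d" if "\<alpha>' \<in> mindices s" for k and \<alpha>' :: "'n mindex"
    using mindices_add[OF that, of 0 0 d] mindices_add[OF that, of "axis k 1" 1 d] \<open>s < d\<close> by auto
  have "p = 0 \<or> p = 1 \<or> p = 2" "q = 0 \<or> q = 1 \<or> q = 2"
    using ab by auto
  then show "block_mat (hyponormality_block i j y) a b =
      (\<Sum>z\<in>Z. of_real (w z) * cnj (case a of (p, \<alpha>) \<Rightarrow> cnj (?u p z) * mpow z \<alpha>) *
        (case b of (q, \<beta>) \<Rightarrow> cnj (?u q z) * mpow z \<beta>))"
    using ab(5,6) unfolding ab(1,2) block_mat_def
    by (elim disjE) (auto simp: loc_mat_one loc_mat_pvar loc_mat_pcvar loc_mat_pcvar_pvar y mem mpow_add mult_ac)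
qed (use mom in \<open>auto simp: atomic_moments_def less_imp_le\<close>)

lemma contains_le_if: "contains_le_or_eq m g p q \<Longrightarrow> \<exists>i\<in>{1..m}. g i = q - p"
  unfolding contains_le_or_eq_def contains_eq_def contains_le_def by blast

lemma real_polys_peval:
  assumes "\<phi> \<in> real_polys l"
  shows "peval \<phi> z = of_real (Re (peval \<phi> z))"
  using assms unfolding real_polys_def by (simp add: complex_is_Real_iff complex_eq_iff)

section \<open>The equivalence and the count of zeros\<close>

theorem theorem3p8:
  fixes g :: "nat \<Rightarrow> 'n::{finite,linorder} cpoly"
    and k :: "nat \<Rightarrow> nat"
    and m d dK :: nat
    and K :: "(complex ^ 'n::{finite,linorder}) set"
    and y :: "'n mindex \<Rightarrow> 'n mindex \<Rightarrow> complex"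
  assumes "CARD('n) > 1" and "m \<ge> 1"
    and "\<forall>i\<in>{1..m}. has_degree (g i) (k i)"
    and "K = feasible_set m g"
    and "dK = Max (k ` {1..m})"
    and "hermitian_family d y" and "d \<ge> dK"
    and "(\<exists>R :: 'n \<Rightarrow> real. \<forall>l. R l \<ge> 0 \<and>
            contains_le_or_eq m g (pcvar l * pvar l) (pconst (of_real ((R l)\<^sup>2)))) \<or>
         (\<exists>R :: real. R \<ge> 0 \<and>
            contains_le_or_eq m g (\<Sum>l\<in>UNIV. pcvar l * pvar l) (pconst (of_real (R\<^sup>2))))"
  shows
    "((\<exists>\<mu>. atomic_representing_measure (rank_mat (mindices (d - dK)) (loc_mat 1 y)) K d y \<mu>)
      \<longleftrightarrow>
        (psd_mat (mindices d) (loc_mat 1 y) \<and>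
         (\<forall>i\<in>{1..m}. psd_mat (mindices (d - k i)) (loc_mat (g i) y))) \<and>
        rank_mat (mindices d) (loc_mat 1 y) = rank_mat (mindices (d - dK)) (loc_mat 1 y) \<and>
        (\<forall>i j :: 'n. i < j \<longrightarrow>
          psd_mat ({..<3} \<times> mindices (d - dK)) (block_mat
            [[loc_mat 1 y, loc_mat (pcvar i) y, loc_mat (pcvar j) y],
             [loc_mat (pvar i) y, loc_mat (pcvar i * pvar i) y, loc_mat (pcvar j * pvar i) y],
             [loc_mat (pvar j) y, loc_mat (pcvar i * pvar j) y, loc_mat (pcvar j * pvar j) y]])))
     \<and>
     (\<forall>\<mu>. atomic_representing_measure (rank_mat (mindices (d - dK)) (loc_mat 1 y)) K d y \<mu> \<longrightarrow>
        (\<forall>i\<in>{1..m}. int (card {z \<in> atoms \<mu>. peval (g i) z = 0}) =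
           int (rank_mat (mindices d) (loc_mat 1 y)) -
           int (rank_mat (mindices (d - dK)) (loc_mat (g i) y))))"
proof -
  let ?D = "mindices d :: 'n mindex set" and ?A = "mindices (d - dK) :: 'n mindex set"
  \<comment> \<open>Both alternatives are brought to one shape, with \<open>L\<close> either the
    singleton of \<open>l\<close> or all coordinates; an equality contributes its upper
    bound.\<close>
  have ball: "\<exists>i\<in>{1..m}. \<exists>L c. l \<in> L \<and> g i = pconst (of_real c) - (\<Sum>l\<in>L. pcvar l * pvar l)" for l
    using assms(8)
  proof (elim disjE exE conjE)
    fix R :: "'n \<Rightarrow> real"
    assume "\<forall>l. R l \<ge> 0 \<and> contains_le_or_eq m g (pcvar l * pvar l) (pconst (of_real ((R l)\<^sup>2)))"
    then obtain i where i: "i \<in> {1..m}" "g i = pconst (of_real ((R l)\<^sup>2)) - pcvar l * pvar l"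
      using contains_le_if by blast
    then show ?thesis
      by (intro bexI[of _ i] exI[of _ "{l}"] exI[of _ "(R l)\<^sup>2"]) simp_all
  next
    fix R :: real
    assume "contains_le_or_eq m g (\<Sum>l\<in>UNIV. pcvar l * pvar l) (pconst (of_real (R\<^sup>2)))"
    then obtain i where "i \<in> {1..m}" "g i = pconst (of_real (R\<^sup>2)) - (\<Sum>l\<in>UNIV. pcvar l * pvar l)"
      using contains_le_if by blast
    then show ?thesis
      by (intro bexI[of _ i] exI[of _ UNIV] exI[of _ "R\<^sup>2"]) simp_all
  qed
  have k_le: "k i \<le> dK" if "i \<in> {1..m}" for i
    using that unfolding assms(5) by simp
  have g: "g i \<in> real_polys (k i)" if "i \<in> {1..m}" for i
    using assms(3) that unfolding has_degree_def by blast
  have k_ball: "k i = 1" if "i \<in> {1..m}" "l \<in> L" "g i = pconst c - (\<Sum>l\<in>L. pcvar l * pvar l)" for i l L c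
    using ball_constraint_degree[of c L "k i"] assms(3) that by (metis empty_iff)
  have "1 \<le> dK"
  proof -
    \<comment> \<open>\<open>undefined\<close> stands for an arbitrary coordinate.\<close>
    obtain i L c where i: "i \<in> {1..m}" "undefined \<in> L"
      "g i = pconst (of_real c) - (\<Sum>l\<in>L. pcvar l * pvar l)"
      using ball[of undefined] by blast
    show ?thesis
      using k_ball[OF i] k_le[OF i(1)] by simp
  qed
  then have s: "d - dK < d" "d - dK + dK = d"
    using assms(7) by simp_all
  have A_sub: "?A \<subseteq> mindices (d - k i)" if "i \<in> {1..m}" for i
    using k_le[OF that] by (auto intro: mindices_mono[THEN subsetD, rotated])
  have AD: "?A \<subseteq> ?D"
    by (auto intro: mindices_mono[THEN subsetD, rotated])
  have moments: "y \<alpha> \<beta> = (\<Sum>z\<in>Z. of_real (w z) * cnj (mpow z \<alpha>) * mpow z \<beta>)"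
    if "atomic_moments d y Z w" "\<alpha> \<in> ?D" "\<beta> \<in> ?D" for Z w \<alpha> \<beta>
    using that unfolding atomic_moments_def by blast
  \<comment> \<open>Spanning persists when the index set grows, so the rank is the same for all
    index sets between order \<open>d - dK\<close> and order \<open>d\<close>.\<close>
  have rank_moments: "rank_mat B y = card Z"
    if "atomic_moments d y Z w" "spanning ?A Z (\<lambda>\<alpha> z. mpow z \<alpha>)" "?A \<subseteq> B" "B \<subseteq> ?D" for Z w B
  proof -
    have fin: "finite B"
      using that(4) finite_mindices finite_subset by blast
    have w: "finite Z" "\<And>z. z \<in> Z \<Longrightarrow> 0 < w z"
      using that(1) unfolding atomic_moments_def by auto
    have "rank_mat B y = card {z \<in> Z. w z \<noteq> 0}"
      by (rule rank_atomic[OF w(1) fin spanning_mono[OF that(2,3) fin]])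
         (use w(2) moments[OF that(1)] that(4) in \<open>auto simp: less_imp_le\<close>)
    also have "{z \<in> Z. w z \<noteq> 0} = Z"
      using w(2) by fastforce
    finally show ?thesis .
  qed
  have loc: "loc_mat (g i) y \<alpha> \<beta> = (\<Sum>z\<in>Z. of_real (w z * Re (peval (g i) z)) * cnj (mpow z \<alpha>) * mpow z \<beta>)"
    if "atomic_moments d y Z w" "i \<in> {1..m}" "\<alpha> \<in> mindices (d - k i)" "\<beta> \<in> mindices (d - k i)" for Z w i \<alpha> \<beta>
  proof -
    have "loc_mat (g i) y \<alpha> \<beta> = (\<Sum>z\<in>Z. of_real (w z) * peval (g i) z * cnj (mpow z \<alpha>) * mpow z \<beta>)"
      using g[OF that(2)] k_le[OF that(2)] assms(7) that(3,4)
      by (intro loc_mat_atomic[OF that(1), of _ "k i" "d - k i"]) (auto simp: real_polys_def)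
    then show ?thesis
      using real_polys_peval[OF g[OF that(2)]] by simp
  qed
  have from_measure: "\<exists>Z w. atomic_moments d y Z w \<and> spanning ?A Z (\<lambda>\<alpha> z. mpow z \<alpha>) \<and> Z \<subseteq> K \<and> atoms \<mu> = Z"
    if rep: "atomic_representing_measure (rank_mat ?A y) K d y \<mu>" for \<mu>
  proof -
    obtain Z w where Z: "atomic_moments d y Z w" "card Z = rank_mat ?A y" "Z \<subseteq> K" "atoms \<mu> = Z"
      using atomic_representing_measure_moments[OF rep] by blast
    have "spanning ?A Z (\<lambda>\<alpha> z. mpow z \<alpha>)"
      by (rule spanning_atomic[of Z ?A w y])
         (use Z moments[OF Z(1)] AD in \<open>auto simp: atomic_moments_def finite_mindices\<close>)
    then show ?thesis
      using Z by blast
  qed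
  have nonneg: "0 \<le> w z * Re (peval (g i) z)"
    if "atomic_moments d y Z w" "Z \<subseteq> K" "i \<in> {1..m}" "z \<in> Z" for Z w i z
    using that unfolding assms(4) feasible_set_def atomic_moments_def
    by (auto intro!: mult_nonneg_nonneg simp: less_imp_le)
  let ?cond1 = "psd_mat ?D y \<and> (\<forall>i\<in>{1..m}. psd_mat (mindices (d - k i)) (loc_mat (g i) y))"
  let ?cond3 = "\<forall>i j. i < j \<longrightarrow> psd_mat ({..<3} \<times> ?A) (block_mat (hyponormality_block i j y))"
  have necessity: "?cond1 \<and> rank_mat ?D y = rank_mat ?A y \<and> ?cond3"
    if rep: "atomic_representing_measure (rank_mat ?A y) K d y \<mu>" for \<mu>
  proof -
    obtain Z w where Z: "atomic_moments d y Z w" "spanning ?A Z (\<lambda>\<alpha> z. mpow z \<alpha>)" "Z \<subseteq> K"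
      using from_measure[OF rep] by blast
    have "psd_mat ?D y"
      by (rule psd_atomic[OF _ moments[OF Z(1)]]) (use Z(1) in \<open>auto simp: atomic_moments_def less_imp_le\<close>)
    moreover have "psd_mat (mindices (d - k i)) (loc_mat (g i) y)" if "i \<in> {1..m}" for i
      by (rule psd_atomic[OF nonneg[OF Z(1,3) that] loc[OF Z(1) that]])
    moreover have "rank_mat ?D y = rank_mat ?A y"
      using rank_moments[OF Z(1,2)] AD by simp
    ultimately show ?thesis
      using hyponormality_block_psd[OF Z(1) s(1)] by blast
  qed
  have sufficiency: "\<exists>\<mu>. atomic_representing_measure (rank_mat ?A y) K d y \<mu>"
    if c1: "psd_mat ?D y" "\<And>i. i \<in> {1..m} \<Longrightarrow> psd_mat (mindices (d - k i)) (loc_mat (g i) y)"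
      and c2: "rank_mat ?D y = rank_mat ?A y" and c3: ?cond3
  proof -
    have bound: "\<exists>C. \<forall>v. Re (sesq (mindices (d - 1)) (\<lambda>\<alpha> \<beta>. y (\<alpha> + axis l 1) (\<beta> + axis l 1)) v v)
        \<le> C * Re (sesq (mindices (d - 1)) y v v)" for l
    proof -
      obtain i L c where i: "i \<in> {1..m}" "l \<in> L" "g i = pconst (of_real c) - (\<Sum>l\<in>L. pcvar l * pvar l)"
        using ball[of l] by blast
      show ?thesis
        using ball_constraint_bound[OF c1(1) _ i(2), of c] c1(2)[OF i(1)] k_ball[OF i] i(3) s(1) by auto
    qed
    have pos: "0 \<le> Re (sesq ?A y u0 u0
        + (\<Sum>k\<in>{i, j}. sesq ?A (\<lambda>\<alpha> \<beta>. y (\<alpha> + axis k 1) \<beta>) u0 (u k)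
                     + sesq ?A (\<lambda>\<alpha> \<beta>. y \<alpha> (\<beta> + axis k 1)) (u k) u0)
        + (\<Sum>k\<in>{i, j}. \<Sum>l\<in>{i, j}. sesq ?A (\<lambda>\<alpha> \<beta>. y (\<alpha> + axis l 1) (\<beta> + axis k 1)) (u k) (u l)))"
      if "i \<noteq> j" for i j :: 'n and u0 u
    \<comment> \<open>Condition 3 lists only the pairs with \<open>i < j\<close>, but the form
      depends only on the set \<open>{i, j}\<close>.\<close>
    proof (cases "i < j")
      case True
      then show ?thesis
        by (intro hyponormality_block_form[OF _ that] c3[rule_format])
    next
      case False
      then have "j < i"
        using that by simp
      then show ?thesis
        unfolding insert_commute[of i j "{}"]
        by (intro hyponormality_block_form[OF _ that[symmetric]] c3[rule_format])
    qed
    obtain Z w where Z: "atomic_moments d y Z w" "spanning ?A Z (\<lambda>\<alpha> z. mpow z \<alpha>)"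
      using flat_extension_atoms[OF s(1) c1(1) c2 bound assms(1) pos] by blast
    have "Z \<subseteq> K"
    proof
      fix z assume z: "z \<in> Z"
      have "0 \<le> Re (peval (g i) z)" if i: "i \<in> {1..m}" for i
      proof (rule atoms_nonneg[OF Z g[OF i] _ _ z])
        show "d - dK + k i \<le> d"
          using k_le[OF i] s(2) by simp
        \<comment> \<open>Positivity at order \<open>d - k i\<close> is restricted to order
          \<open>d - dK\<close>, where the monomials are known to separate the atoms.\<close>
        show "psd_mat ?A (loc_mat (g i) y)"
          using psd_mat_subset[OF c1(2)[OF i] A_sub[OF i] finite_mindices] .
      qed
      then show "z \<in> K"
        unfolding assms(4) feasible_set_def by blast
    qed
    moreover have "rank_mat ?A y = card Z"
      using rank_moments[OF Z _ AD] by simp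
    ultimately show ?thesis
      using atomic_representing_measure_of_moments[OF Z(1)] by simp
  qed
  have zeros: "int (card {z \<in> atoms \<mu>. peval (g i) z = 0}) =
      int (rank_mat ?D y) - int (rank_mat ?A (loc_mat (g i) y))"
    if rep: "atomic_representing_measure (rank_mat ?A y) K d y \<mu>" and i: "i \<in> {1..m}" for \<mu> i
  proof -
    obtain Z w where Z: "atomic_moments d y Z w" "spanning ?A Z (\<lambda>\<alpha> z. mpow z \<alpha>)" "Z \<subseteq> K" "atoms \<mu> = Z"
      using from_measure[OF rep] by blast
    have fin: "finite Z" and w: "\<And>z. z \<in> Z \<Longrightarrow> 0 < w z"
      using Z(1) unfolding atomic_moments_def by auto
    \<comment> \<open>The atoms lie in \<open>K\<close>, so the weights
      \<open>w z * Re (peval (g i) z)\<close> are nonnegative and the rank counts the nonzero ones.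
      As \<open>w z > 0\<close>, these belong to the atoms where \<open>g i\<close> does not
      vanish.\<close>
    have "rank_mat ?A (loc_mat (g i) y) = card {z \<in> Z. w z * Re (peval (g i) z) \<noteq> 0}"
      by (rule rank_atomic[OF fin finite_mindices Z(2) nonneg[OF Z(1,3) i]])
         (use A_sub[OF i] loc[OF Z(1) i] in auto)
    also have "{z \<in> Z. w z * Re (peval (g i) z) \<noteq> 0} = Z - {z \<in> Z. peval (g i) z = 0}"
      using w real_polys_peval[OF g[OF i]] by (auto simp: less_le complex_eq_iff)
    also have "card \<dots> = card Z - card {z \<in> Z. peval (g i) z = 0}"
      using fin by (intro card_Diff_subset) auto
    finally have "rank_mat ?A (loc_mat (g i) y) = card Z - card {z \<in> Z. peval (g i) z = 0}" .
    \<comment> \<open>Excludes truncation in the subtraction of natural numbers, so that it agrees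
      with the integer difference.\<close>
    moreover have "card {z \<in> Z. peval (g i) z = 0} \<le> card Z"
      using fin by (intro card_mono) auto
    moreover have "rank_mat ?D y = card Z"
      using rank_moments[OF Z(1,2)] AD by simp
    ultimately show ?thesis
      unfolding Z(4) by simp
  qed
  have "(\<exists>\<mu>. atomic_representing_measure (rank_mat ?A y) K d y \<mu>) \<longleftrightarrow>
      ?cond1 \<and> rank_mat ?D y = rank_mat ?A y \<and> ?cond3"
    using necessity sufficiency by blast
  moreover have "\<forall>\<mu>. atomic_representing_measure (rank_mat ?A y) K d y \<mu> \<longrightarrow>
      (\<forall>i\<in>{1..m}. int (card {z \<in> atoms \<mu>. peval (g i) z = 0}) =
        int (rank_mat ?D y) - int (rank_mat ?A (loc_mat (g i) y)))"
    using zeros by blast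
  ultimately show ?thesis
    unfolding loc_mat_one ..
qed

end
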